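(* Let $p$ be an odd prime, and let $1\to N\to H\to G\to 1$ be a group extension, where $G$ is a finite powerful $p$-group (and $H$ is an arbitrary group). The following statements hold. (i) If $N\leqslant Z_n(H)$ for some positive integer $n$, then the $(n+1)$-th term $\gamma_{n+1}(H)$ of the lower central series of $H$ is a finite powerful $p$-group. (ii) If $N\leqslant\mathcal{D}_n(H)$ for some positive integer $n$, then the $(n+1)$-th term $\Gamma_{n+1}(H)$ of the derived series of $H$ is a finite powerful $p$-group.
   Context: For $p$ odd, a finite $p$-group $P$ is powerful if $[P,P]\leqslant P^p$, where $P^p$ is the subgroup generated by $p$th powers. $\gamma_1(H)=H$, $\gamma_{n+1}(H)=[\gamma_n(H),H]$. $\Gamma_1(H)=H$, $\Gamma_{n+1}(H)=[\Gamma_n(H),\Gamma_n(H)]$ (derived series of the abstract group $H$). $Z_n(H)$ is the $n$th center: $Z_0(H)=1$, $Z_n(H)/Z_{n-1}(H)=Z(H/Z_{n-1}(H))$. For $n\geq1$, $$\mathcal{D}_n(H)=\{h\in H\mid[\ldots[[h,x_1],x_2],\ldots,x_n]=1\text{ for all }x_i\in\Gamma_i(H),\ 1\le i\le n\},$$ a normal subgroup of $H$. $N$ is identified with its image in $H$. *)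

theory Defs
  imports "HOL-Algebra.Algebra"
begin

text \<open>A short exact sequence \<open>1 \<rightarrow> N \<rightarrow> H \<rightarrow> G \<rightarrow> 1\<close> with maps \<open>f\<close> and \<open>g\<close>. The library's
  \<open>exact_seq\<close> is not used because it forces the three groups to share one element type.\<close>

definition group_extension ::
  "('a, 'm) monoid_scheme \<Rightarrow> ('a \<Rightarrow> 'b) \<Rightarrow> ('b, 'n) monoid_scheme \<Rightarrow> ('b \<Rightarrow> 'c)
    \<Rightarrow> ('c, 'k) monoid_scheme \<Rightarrow> bool"
  where "group_extension N f H g G \<longleftrightarrow>
    group N \<and> group H \<and> group G \<and> f \<in> mon N H \<and> g \<in> epi H G \<and>
    f ` carrier N = kernel H G g"

definition finite_p_group :: "nat \<Rightarrow> ('a, 'm) monoid_scheme \<Rightarrow> bool"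
  where "finite_p_group p P \<longleftrightarrow> group P \<and> finite (carrier P) \<and> (\<exists>k. order P = p ^ k)"

definition power_subgroup :: "('a, 'm) monoid_scheme \<Rightarrow> nat \<Rightarrow> 'a set"
  where "power_subgroup P m = generate P ((\<lambda>x. x [^]\<^bsub>P\<^esub> m) ` carrier P)"

text \<open>This is the notion of powerful \<open>p\<close>-group for odd \<open>p\<close>; for \<open>p = 2\<close> the usual
  definition uses fourth powers instead.\<close>

definition finite_powerful_p_group :: "nat \<Rightarrow> ('a, 'm) monoid_scheme \<Rightarrow> bool"
  where "finite_powerful_p_group p P \<longleftrightarrow>
    finite_p_group p P \<and> derived P (carrier P) \<subseteq> power_subgroup P p"

text \<open>The commutator convention is that of the library's \<open>derived_set\<close>. The subgroups defined
  below do not change if \<open>x\<inverse> y\<inverse> x y\<close> is used instead.\<close>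

definition commutator :: "('a, 'm) monoid_scheme \<Rightarrow> 'a \<Rightarrow> 'a \<Rightarrow> 'a"
  where "commutator G x y = x \<otimes>\<^bsub>G\<^esub> y \<otimes>\<^bsub>G\<^esub> inv\<^bsub>G\<^esub> x \<otimes>\<^bsub>G\<^esub> inv\<^bsub>G\<^esub> y"

definition commutator_subgroup :: "('a, 'm) monoid_scheme \<Rightarrow> 'a set \<Rightarrow> 'a set \<Rightarrow> 'a set"
  where "commutator_subgroup G A B = generate G {commutator G a b | a b. a \<in> A \<and> b \<in> B}"

lemma derived_eq_commutator_subgroup: "derived G A = commutator_subgroup G A A"
  unfolding derived_def commutator_subgroup_def commutator_def
  by (rule arg_cong[of _ _ "generate G"]) blast

text \<open>Both series are indexed from 1; the value at index 0 is not meaningful.\<close>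

definition lower_central :: "('a, 'm) monoid_scheme \<Rightarrow> nat \<Rightarrow> 'a set"
  where "lower_central G n =
    ((\<lambda>K. commutator_subgroup G K (carrier G)) ^^ (n - 1)) (carrier G)"

definition derived_series :: "('a, 'm) monoid_scheme \<Rightarrow> nat \<Rightarrow> 'a set"
  where "derived_series G n = (derived G ^^ (n - 1)) (carrier G)"

definition group_center :: "('a, 'm) monoid_scheme \<Rightarrow> 'a set"
  where "group_center G = {z \<in> carrier G. \<forall>x \<in> carrier G. z \<otimes>\<^bsub>G\<^esub> x = x \<otimes>\<^bsub>G\<^esub> z}"

text \<open>\<open>upper_central G (Suc n)\<close> is the preimage in \<open>G\<close> of the center of
  \<open>G Mod upper_central G n\<close>.\<close>

primrec upper_central :: "('a, 'm) monoid_scheme \<Rightarrow> nat \<Rightarrow> 'a set"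
  where
    "upper_central G 0 = {\<one>\<^bsub>G\<^esub>}"
  | "upper_central G (Suc n) =
      {g \<in> carrier G. upper_central G n #>\<^bsub>G\<^esub> g \<in> group_center (G Mod upper_central G n)}"

text \<open>With \<open>xs = [x\<^sub>1, \<dots>, x\<^sub>n]\<close>, the fold is the left-normed commutator
  \<open>[\<dots>[[h, x\<^sub>1], x\<^sub>2], \<dots>, x\<^sub>n]\<close>.\<close>

definition derived_center :: "('a, 'm) monoid_scheme \<Rightarrow> nat \<Rightarrow> 'a set"
  where "derived_center G n =
    {h \<in> carrier G. \<forall>xs. length xs = n \<and> (\<forall>i \<in> {1..n}. xs ! (i - 1) \<in> derived_series G i)
       \<longrightarrow> foldl (commutator G) h xs = \<one>\<^bsub>G\<^esub>}"

end

theory Submission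
  imports Defs
begin

text \<open>
  Everything rests on one step. Let \<open>K\<close>, \<open>L\<close> and \<open>W \<subseteq> A\<close> be normal subgroups with
  \<open>[L, A] \<subseteq> K\<close>, where \<open>A\<close> acts nilpotently modulo \<open>K\<close>, and suppose that \<open>W\<close> is modulo \<open>L\<close> a
  finite \<open>p\<close>-group with \<open>[W, A] \<subseteq> W\<^sup>p L\<close>. Then \<open>T = [W, A]\<close> is modulo \<open>K\<close> a finite \<open>p\<close>-group with
  \<open>[T, A] \<subseteq> T\<^sup>p K\<close>. For the last containment, nilpotency reduces to the case where \<open>T\<^sup>p\<close> and
  \<open>[T, A, A]\<close> vanish modulo \<open>K\<close>; then \<open>[w\<^sup>p, a]\<close> vanishes by a class-two computation, so \<open>A\<close>
  centralizes \<open>W\<^sup>p L\<close>, which contains \<open>T\<close>.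

  Part (i) iterates the step along \<open>\<gamma>\<^sub>i\<close> with \<open>A = H\<close> and \<open>L\<close>, \<open>K\<close> consecutive upper central
  terms, part (ii) along the derived series with \<open>A = W = \<Gamma>\<^sub>i\<close>.
\<close>

section \<open>Commutators and centralizers modulo normal subgroups\<close>

text \<open>\<open>H\<close> and \<open>N\<close> may be infinite, so a term of either series need
  not be a finite group before the last step. All statements therefore live in one fixed group and
  are relative to a normal subgroup; each step moves the series down by one term and replaces the
  modulus \<open>L\<close> by a smaller \<open>K\<close>, which is trivial after \<open>n\<close>
  steps. The delicate point is finiteness. \<open>[L, A] \<subseteq> K\<close> makes
  \<open>[w, a]\<close> modulo \<open>K\<close> depend only on \<open>w\<close> modulo
  \<open>L\<close>, but \<open>A\<close> may be infinite modulo \<open>L\<close>. A subgroup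
  \<open>D\<close> of finite index in \<open>A\<close> that \<open>W\<close> centralizes modulo
  \<open>K\<close> handles the second argument: in part (i) it is \<open>upper_central H n\<close>
  at every step, in part (ii) it is \<open>L\<close> itself. Nilpotent action is written
  \<open>(centralizer_mod G A ^^ c) K = carrier G\<close>: all commutators
  \<open>[x, a\<^sub>1, ..., a\<^sub>c]\<close> lie in \<open>K\<close>. It originates in the
  nilpotency of the finite \<open>p\<close>-group that is extended.\<close>

definition centralizer_mod :: "('a, 'm) monoid_scheme \<Rightarrow> 'a set \<Rightarrow> 'a set \<Rightarrow> 'a set"
  where "centralizer_mod G A M = {x \<in> carrier G. \<forall>a\<in>A. commutator G x a \<in> M}"

text \<open>\<open>S\<close> may be any set, not only a subgroup containing \<open>K\<close>, so
  that the notion also applies to a set of commutators.\<close>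

definition finite_mod :: "('a, 'm) monoid_scheme \<Rightarrow> 'a set \<Rightarrow> 'a set \<Rightarrow> bool"
  where "finite_mod G S K \<longleftrightarrow> finite ((\<lambda>x. K #>\<^bsub>G\<^esub> x) ` S)"

lemma (in group) inv_cancel:
  assumes "x \<in> carrier G" "y \<in> carrier G"
  shows "inv x \<otimes> (x \<otimes> y) = y" "x \<otimes> (inv x \<otimes> y) = y"
  using assms by (simp_all add: m_assoc[symmetric])

text \<open>As rewrite rules these bring a word to reduced, right-nested form. Commutator identities
  then follow by unfolding \<open>commutator_def\<close>.\<close>

lemmas (in group) group_word = m_assoc inv_mult_group inv_cancel

lemma (in group) commutator_closed [simp, intro]:
  "x \<in> carrier G \<Longrightarrow> y \<in> carrier G \<Longrightarrow> commutator G x y \<in> carrier G"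
  by (simp add: commutator_def)

lemma (in group) commutator_eq_one_iff:
  assumes "x \<in> carrier G" "y \<in> carrier G"
  shows "commutator G x y = \<one> \<longleftrightarrow> x \<otimes> y = y \<otimes> x"
proof -
  have "x \<otimes> y = commutator G x y \<otimes> (y \<otimes> x)"
    using assms by (simp add: commutator_def group_word)
  then show ?thesis
    using assms by (metis commutator_closed m_closed r_cancel_one')
qed

lemma (in group) conj_commutator:
  assumes "g \<in> carrier G" "x \<in> carrier G" "y \<in> carrier G"
  shows "g \<otimes> commutator G x y \<otimes> inv g
    = commutator G (g \<otimes> x \<otimes> inv g) (g \<otimes> y \<otimes> inv g)"
  using assms by (simp add: commutator_def group_word)

lemma (in group) inv_commutator:
  assumes "x \<in> carrier G" "y \<in> carrier G"
  shows "inv (commutator G x y) = commutator G y x"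
  using assms by (simp add: commutator_def group_word)

lemma (in group_hom) hom_commutator:
  assumes "x \<in> carrier G" "y \<in> carrier G"
  shows "h (commutator G x y) = commutator H (h x) (h y)"
  using assms by (simp add: commutator_def)

lemma (in group) commutator_in_normal:
  assumes "M \<lhd> G"
  shows "x \<in> M \<Longrightarrow> y \<in> carrier G \<Longrightarrow> commutator G x y \<in> M"
    and "x \<in> carrier G \<Longrightarrow> y \<in> M \<Longrightarrow> commutator G x y \<in> M"
proof -
  interpret M: normal M G by fact
  show "commutator G x y \<in> M" if "x \<in> M" "y \<in> carrier G"
  proof -
    have "commutator G x y = x \<otimes> (y \<otimes> inv x \<otimes> inv y)"
      using that by (simp add: commutator_def group_word)
    then show ?thesis using that M.inv_op_closed2 by simp
  qed
  show "commutator G x y \<in> M" if "x \<in> carrier G" "y \<in> M"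
    using that M.inv_op_closed2 by (simp add: commutator_def)
qed

lemma (in normal) group_hom_Mod: "group_hom G (G Mod H) ((#>) H)"
  unfolding group_hom_def group_hom_axioms_def
  using is_group factorgroup_is_group r_coset_hom_Mod by blast

lemma (in normal) coset_eq_one_iff:
  assumes "x \<in> carrier G"
  shows "H #> x = \<one>\<^bsub>G Mod H\<^esub> \<longleftrightarrow> x \<in> H"
proof -
  have "H #> x = H \<longleftrightarrow> x \<in> H"
    using coset_join1[OF _ assms subgroup_axioms] coset_join2[OF assms subgroup_axioms] by blast
  then show ?thesis by simp
qed

lemma (in normal) coset_eq_iff:
  assumes "x \<in> carrier G" "y \<in> carrier G"
  shows "H #> x = H #> y \<longleftrightarrow> x \<otimes> inv y \<in> H"
proof -
  have "H #> x = H #> y \<longleftrightarrow> H #> (x \<otimes> inv y) = H"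
    using coset_mult_inv1[OF _ assms subset] coset_mult_inv2[OF _ assms subset] by blast
  also have "\<dots> \<longleftrightarrow> x \<otimes> inv y \<in> H"
    using coset_join1[OF _ _ subgroup_axioms] coset_join2[OF _ subgroup_axioms] assms
    by (metis inv_closed m_closed)
  finally show ?thesis .
qed

lemma (in normal) finite_mod_representatives:
  assumes "finite_mod G S H" "S \<subseteq> carrier G"
  obtains F where "finite F" "F \<subseteq> S" "\<And>s. s \<in> S \<Longrightarrow> \<exists>f\<in>F. s \<otimes> inv f \<in> H"
proof -
  obtain F where F: "finite F" "F \<subseteq> S" "(\<lambda>x. H #> x) ` S = (\<lambda>x. H #> x) ` F"
    using finite_subset_image[OF assms(1)[unfolded finite_mod_def] subset_refl] by blast
  have "\<exists>f\<in>F. s \<otimes> inv f \<in> H" if s: "s \<in> S" for s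
  proof -
    obtain f where f: "f \<in> F" "H #> s = H #> f" using F(3) s by blast
    then have "s \<otimes> inv f \<in> H" using coset_eq_iff[of s f] s F(2) assms(2) by auto
    then show ?thesis using f by blast
  qed
  then show ?thesis using that F by blast
qed

lemma (in normal) finite_modI:
  assumes "finite F" "F \<subseteq> carrier G" "S \<subseteq> carrier G" "\<And>s. s \<in> S \<Longrightarrow> \<exists>f\<in>F. s \<otimes> inv f \<in> H"
  shows "finite_mod G S H"
  unfolding finite_mod_def
proof (rule finite_subset)
  show "(\<lambda>x. H #> x) ` S \<subseteq> (\<lambda>x. H #> x) ` F"
  proof
    fix c assume "c \<in> (\<lambda>x. H #> x) ` S"
    then obtain s where s: "s \<in> S" "c = H #> s" by blast
    obtain f where f: "f \<in> F" "s \<otimes> inv f \<in> H" using assms(4)[OF s(1)] by blast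
    then have "c = H #> f" using coset_eq_iff[of s f] s assms(2,3) by auto
    then show "c \<in> (\<lambda>x. H #> x) ` F" using f by blast
  qed
qed (use assms(1) in simp)

text \<open>The bridge by which computations carried out in an arbitrary group are applied in
  \<open>G Mod H\<close> and read back as membership in \<open>H\<close>.\<close>

lemma (in normal) commutator_mem_iff:
  assumes "x \<in> carrier G" "y \<in> carrier G"
  shows "commutator G x y \<in> H \<longleftrightarrow>
    (H #> x) \<otimes>\<^bsub>G Mod H\<^esub> (H #> y) = (H #> y) \<otimes>\<^bsub>G Mod H\<^esub> (H #> x)"
proof -
  interpret q: group_hom G "G Mod H" "(#>) H" by (rule group_hom_Mod)
  show ?thesis
    unfolding coset_eq_one_iff[OF commutator_closed[OF assms], symmetric] q.hom_commutator[OF assms]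
    using assms by (intro q.H.commutator_eq_one_iff q.hom_closed)
qed

lemma (in normal) nat_pow_mem_iff:
  assumes "x \<in> carrier G"
  shows "x [^] (n::nat) \<in> H \<longleftrightarrow> (H #> x) [^]\<^bsub>G Mod H\<^esub> n = \<one>\<^bsub>G Mod H\<^esub>"
proof -
  interpret q: group_hom G "G Mod H" "(#>) H" by (rule group_hom_Mod)
  show ?thesis
    unfolding coset_eq_one_iff[OF nat_pow_closed[OF assms], symmetric] q.hom_nat_pow[OF assms] ..
qed

section \<open>Commutator subgroups and relative centralizers\<close>

lemma (in group) commutator_subgroup_gens_closed:
  assumes "U \<subseteq> carrier G" "A \<subseteq> carrier G"
  shows "{commutator G x a | x a. x \<in> U \<and> a \<in> A} \<subseteq> carrier G"
  using assms by blast

lemma (in group) commutator_in_commutator_subgroup: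
  "x \<in> U \<Longrightarrow> a \<in> A \<Longrightarrow> commutator G x a \<in> commutator_subgroup G U A"
  unfolding commutator_subgroup_def by (rule generate.incl) blast

lemma (in group) commutator_subgroup_subset:
  assumes "subgroup M G" "\<And>x a. x \<in> U \<Longrightarrow> a \<in> A \<Longrightarrow> commutator G x a \<in> M"
  shows "commutator_subgroup G U A \<subseteq> M"
  unfolding commutator_subgroup_def using assms by (intro generate_subgroup_incl) auto

lemma (in group) commutator_subgroup_mono:
  assumes "U \<subseteq> Y" "A \<subseteq> B"
  shows "commutator_subgroup G U A \<subseteq> commutator_subgroup G Y B"
  unfolding commutator_subgroup_def using assms by (intro mono_generate) blast

lemma (in group) normal_subset: "M \<lhd> G \<Longrightarrow> M \<subseteq> carrier G"
  using normal_imp_subgroup subgroup.subset by blast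

lemma (in group) conj_commutator_gens:
  assumes "U \<lhd> G" "A \<lhd> G" "g \<in> carrier G"
    and "h \<in> {commutator G x a | x a. x \<in> U \<and> a \<in> A}"
  shows "g \<otimes> h \<otimes> inv g \<in> {commutator G x a | x a. x \<in> U \<and> a \<in> A}"
proof -
  obtain x a where h: "h = commutator G x a" "x \<in> U" "a \<in> A"
    using assms(4) by blast
  then have "x \<in> carrier G" "a \<in> carrier G"
    using assms(1,2)[THEN normal_subset] by auto
  then have "g \<otimes> h \<otimes> inv g = commutator G (g \<otimes> x \<otimes> inv g) (g \<otimes> a \<otimes> inv g)"
    using h assms(3) conj_commutator by simp
  moreover have "g \<otimes> x \<otimes> inv g \<in> U" "g \<otimes> a \<otimes> inv g \<in> A"
    using h normal_invE(2)[OF assms(1) assms(3)] normal_invE(2)[OF assms(2) assms(3)] by auto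
  ultimately show ?thesis by blast
qed

lemma (in group) commutator_subgroup_normal:
  assumes "U \<lhd> G" "A \<lhd> G"
  shows "commutator_subgroup G U A \<lhd> G"
  unfolding commutator_subgroup_def
  by (rule normal_generateI[OF commutator_subgroup_gens_closed[OF assms[THEN normal_subset]]])
    (rule conj_commutator_gens[OF assms])

lemma (in group) commutator_subgroup_subset_left:
  assumes "U \<lhd> G" "A \<subseteq> carrier G"
  shows "commutator_subgroup G U A \<subseteq> U"
  using commutator_in_normal(1)[OF assms(1)] assms(2)
  by (intro commutator_subgroup_subset normal_imp_subgroup[OF assms(1)]) auto

lemma (in group) commutator_subgroup_subset_right:
  assumes "U \<subseteq> carrier G" "A \<lhd> G"
  shows "commutator_subgroup G U A \<subseteq> A"
  using commutator_in_normal(2)[OF assms(2)] assms(1)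
  by (intro commutator_subgroup_subset normal_imp_subgroup[OF assms(2)]) auto

text \<open>Rests on \<open>[x y, a] = x [y, a] x\<inverse> [x, a]\<close> and the normality of
  \<open>M\<close>. \<open>A\<close> is just a set, which covers the centralizer of a single
  element.\<close>

lemma (in group) centralizer_mod_subgroup:
  assumes "A \<subseteq> carrier G" "M \<lhd> G"
  shows "subgroup (centralizer_mod G A M) G"
proof -
  interpret M: normal M G by fact
  have ac: "a \<in> carrier G" if "a \<in> A" for a
    using that assms(1) by blast
  show ?thesis
  proof (rule subgroupI)
    show "centralizer_mod G A M \<subseteq> carrier G"
      by (auto simp: centralizer_mod_def)
    have "\<one> \<in> centralizer_mod G A M"
      using ac by (auto simp: centralizer_mod_def commutator_def)
    then show "centralizer_mod G A M \<noteq> {}" by blast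
  next
    fix x assume "x \<in> centralizer_mod G A M"
    then have x: "x \<in> carrier G" and xM: "\<And>a. a \<in> A \<Longrightarrow> commutator G x a \<in> M"
      by (auto simp: centralizer_mod_def)
    have "commutator G (inv x) a \<in> M" if "a \<in> A" for a
    proof -
      have "commutator G (inv x) a = inv x \<otimes> inv (commutator G x a) \<otimes> x"
        using x ac[OF that] by (simp add: commutator_def group_word)
      then show ?thesis
        using M.inv_op_closed1[OF x] xM[OF that] by simp
    qed
    then show "inv x \<in> centralizer_mod G A M"
      using x by (simp add: centralizer_mod_def)
  next
    fix x y assume "x \<in> centralizer_mod G A M" "y \<in> centralizer_mod G A M"
    then have x: "x \<in> carrier G" "y \<in> carrier G"
      and xM: "\<And>a. a \<in> A \<Longrightarrow> commutator G x a \<in> M" "\<And>a. a \<in> A \<Longrightarrow> commutator G y a \<in> M"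
      by (auto simp: centralizer_mod_def)
    have "commutator G (x \<otimes> y) a \<in> M" if "a \<in> A" for a
    proof -
      have "commutator G (x \<otimes> y) a = (x \<otimes> commutator G y a \<otimes> inv x) \<otimes> commutator G x a"
        using x ac[OF that] by (simp add: commutator_def group_word)
      then show ?thesis
        using M.inv_op_closed2[OF x(1)] xM[OF that] by simp
    qed
    then show "x \<otimes> y \<in> centralizer_mod G A M"
      using x by (simp add: centralizer_mod_def)
  qed
qed

lemma (in group) centralizer_mod_normal:
  assumes "A \<lhd> G" "M \<lhd> G"
  shows "centralizer_mod G A M \<lhd> G"
proof (rule normal_invI)
  show "subgroup (centralizer_mod G A M) G"
    using assms centralizer_mod_subgroup normal_subset by blast
  fix g x assume g: "g \<in> carrier G" and x: "x \<in> centralizer_mod G A M"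
  have xc: "x \<in> carrier G" using x by (simp add: centralizer_mod_def)
  have "commutator G (g \<otimes> x \<otimes> inv g) a \<in> M" if a: "a \<in> A" for a
  proof -
    have ac: "a \<in> carrier G" using a assms(1) normal_subset by blast
    have "inv g \<otimes> a \<otimes> g \<in> A" using normal.inv_op_closed1[OF assms(1) g a] .
    then have "commutator G x (inv g \<otimes> a \<otimes> g) \<in> M"
      using x by (simp add: centralizer_mod_def)
    then have "g \<otimes> commutator G x (inv g \<otimes> a \<otimes> g) \<otimes> inv g \<in> M"
      using normal_invE(2)[OF assms(2) g] by simp
    also have "g \<otimes> commutator G x (inv g \<otimes> a \<otimes> g) \<otimes> inv g = commutator G (g \<otimes> x \<otimes> inv g) a"
      using g xc ac by (simp add: commutator_def group_word)
    finally show ?thesis .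
  qed
  then show "g \<otimes> x \<otimes> inv g \<in> centralizer_mod G A M"
    using g xc by (simp add: centralizer_mod_def)
qed

lemma centralizer_mod_mono:
  "B \<subseteq> A \<Longrightarrow> M \<subseteq> M' \<Longrightarrow> centralizer_mod G A M \<subseteq> centralizer_mod G B M'"
  unfolding centralizer_mod_def by blast

lemma centralizer_mod_funpow_mono:
  "B \<subseteq> A \<Longrightarrow> M \<subseteq> M' \<Longrightarrow> (centralizer_mod G A ^^ n) M \<subseteq> (centralizer_mod G B ^^ n) M'"
  by (induction n) (simp_all add: centralizer_mod_mono)

lemma (in group) centralizer_mod_funpow_normal:
  assumes "A \<lhd> G" "M \<lhd> G"
  shows "(centralizer_mod G A ^^ n) M \<lhd> G"
  using assms by (induction n) (auto intro: centralizer_mod_normal)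

lemma (in group) subset_centralizer_mod:
  assumes "A \<subseteq> carrier G" "M \<lhd> G"
  shows "M \<subseteq> centralizer_mod G A M"
proof
  fix x assume x: "x \<in> M"
  then have "commutator G x a \<in> M" if "a \<in> A" for a
    using commutator_in_normal(1)[OF assms(2)] assms(1) that by blast
  then show "x \<in> centralizer_mod G A M"
    using x normal_subset[OF assms(2)] by (auto simp: centralizer_mod_def)
qed

text \<open>The adjunction between \<open>[_, A]\<close> and \<open>centralizer_mod G A\<close>. It
  trades a bound on a generated subgroup for a condition on elements of \<open>U\<close>.\<close>

lemma (in group) commutator_subgroup_subset_iff:
  assumes "U \<subseteq> carrier G" "subgroup M G"
  shows "commutator_subgroup G U A \<subseteq> M \<longleftrightarrow> U \<subseteq> centralizer_mod G A M"
proof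
  assume "commutator_subgroup G U A \<subseteq> M"
  then show "U \<subseteq> centralizer_mod G A M"
    using assms(1) commutator_in_commutator_subgroup[of _ U _ A] by (auto simp: centralizer_mod_def)
next
  assume "U \<subseteq> centralizer_mod G A M"
  then show "commutator_subgroup G U A \<subseteq> M"
    by (intro commutator_subgroup_subset assms(2)) (auto simp: centralizer_mod_def)
qed

lemma (in group) generate_Un_normal:
  assumes "U \<subseteq> carrier G" "\<And>g x. g \<in> carrier G \<Longrightarrow> x \<in> U \<Longrightarrow> g \<otimes> x \<otimes> inv g \<in> U" "K \<lhd> G"
  shows "generate G (U \<union> K) \<lhd> G"
  using assms normal_subset[OF assms(3)] normal_invE(2)[OF assms(3)]
  by (intro normal_generateI) auto

section \<open>Finiteness modulo a normal subgroup\<close>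

lemma (in group) finite_mod_mono:
  assumes "finite_mod G S M" "S' \<subseteq> S" "M \<subseteq> M'" "M \<lhd> G" "M' \<lhd> G" "S \<subseteq> carrier G"
  shows "finite_mod G S' M'"
proof -
  obtain F where F: "finite F" "F \<subseteq> S" "\<And>s. s \<in> S \<Longrightarrow> \<exists>f\<in>F. s \<otimes> inv f \<in> M"
    using normal.finite_mod_representatives[OF assms(4,1,6)] by metis
  show ?thesis
  proof (rule normal.finite_modI[OF assms(5) F(1)])
    show "\<exists>f\<in>F. s \<otimes> inv f \<in> M'" if "s \<in> S'" for s
      using F(3)[of s] that assms(2,3) by blast
  qed (use F assms in auto)
qed

lemma (in group) finite_mod_trans:
  assumes "finite_mod G R M" "finite_mod G M K" "M \<lhd> G" "K \<lhd> G" "R \<subseteq> carrier G"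
  shows "finite_mod G R K"
proof -
  obtain F where F: "finite F" "F \<subseteq> R" "\<And>s. s \<in> R \<Longrightarrow> \<exists>f\<in>F. s \<otimes> inv f \<in> M"
    using normal.finite_mod_representatives[OF assms(3,1,5)] by metis
  note Mc = normal_subset[OF assms(3)]
  obtain F' where F': "finite F'" "F' \<subseteq> M" "\<And>s. s \<in> M \<Longrightarrow> \<exists>f\<in>F'. s \<otimes> inv f \<in> K"
    using normal.finite_mod_representatives[OF assms(4,2) Mc] by metis
  show ?thesis
  proof (rule normal.finite_modI[OF assms(4)])
    show "finite ((\<lambda>(f', f). f' \<otimes> f) ` (F' \<times> F))" using F(1) F'(1) by simp
    show "(\<lambda>(f', f). f' \<otimes> f) ` (F' \<times> F) \<subseteq> carrier G"
      using subset_trans[OF F(2) assms(5)] subset_trans[OF F'(2) Mc] by (auto intro!: m_closed)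
    fix s assume s: "s \<in> R"
    obtain f where f: "f \<in> F" "s \<otimes> inv f \<in> M" using F(3)[OF s] by blast
    obtain f' where f': "f' \<in> F'" "s \<otimes> inv f \<otimes> inv f' \<in> K" using F'(3)[OF f(2)] by blast
    have "s \<in> carrier G" "f \<in> carrier G" "f' \<in> carrier G"
      using s f(1) f'(1) subset_trans[OF F(2) assms(5)] subset_trans[OF F'(2) Mc] assms(5) by auto
    then have "s \<otimes> inv (f' \<otimes> f) \<in> K"
      using f'(2) by (simp add: group_word)
    then show "\<exists>f\<in>(\<lambda>(f', f). f' \<otimes> f) ` (F' \<times> F). s \<otimes> inv f \<in> K"
      using f(1) f'(1) by auto
  qed (use assms in auto)
qed

section \<open>Powers of commutators\<close>

lemma (in group) nat_pow_commute:
  assumes "x \<in> carrier G" "y \<in> carrier G" "x \<otimes> y = y \<otimes> x"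
  shows "x [^] (n::nat) \<otimes> y = y \<otimes> x [^] n"
proof (induction n)
  case (Suc n)
  have "x [^] Suc n \<otimes> y = x [^] n \<otimes> (x \<otimes> y)"
    using assms(1,2) by (simp add: m_assoc)
  also have "\<dots> = (x [^] n \<otimes> y) \<otimes> x"
    using assms by (simp add: m_assoc)
  also have "\<dots> = y \<otimes> x [^] Suc n"
    using assms(1,2) Suc by (simp add: m_assoc)
  finally show ?case .
qed (use assms in simp)

lemma (in group) inv_commute:
  assumes "x \<in> carrier G" "y \<in> carrier G" "x \<otimes> y = y \<otimes> x"
  shows "inv x \<otimes> y = y \<otimes> inv x"
proof -
  have "inv x \<otimes> y = inv x \<otimes> (y \<otimes> x) \<otimes> inv x"
    using assms(1,2) by (simp add: m_assoc)
  also have "\<dots> = y \<otimes> inv x"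
    unfolding assms(3)[symmetric] using assms(1,2) by (simp add: group_word)
  finally show ?thesis .
qed

text \<open>Collection process: moving \<open>u\<close> to the left past \<open>w [^] n\<close>
  costs \<open>z [^] n\<close>, and \<open>n\<close> plus \<open>n choose 2\<close> is
  \<open>Suc n choose 2\<close>.\<close>

lemma (in group) nat_pow_mult_class_two:
  assumes "u \<in> carrier G" "w \<in> carrier G" "z \<in> carrier G"
    and wu: "w \<otimes> u = u \<otimes> w \<otimes> z" and zu: "z \<otimes> u = u \<otimes> z" and zw: "z \<otimes> w = w \<otimes> z"
  shows "(u \<otimes> w) [^] (n::nat) = u [^] n \<otimes> w [^] n \<otimes> z [^] (n choose 2)"
proof (induction n)
  case (Suc n)
  note carr = assms(1-3)
  have wnu: "w [^] m \<otimes> u = u \<otimes> w [^] m \<otimes> z [^] m" for m :: nat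
  proof (induction m)
    case (Suc m)
    have "w [^] Suc m \<otimes> u = w [^] m \<otimes> u \<otimes> (w \<otimes> z)"
      using carr wu by (simp add: m_assoc)
    also have "\<dots> = u \<otimes> w [^] m \<otimes> (z [^] m \<otimes> w) \<otimes> z"
      using carr Suc by (simp add: m_assoc)
    also have "\<dots> = u \<otimes> w [^] Suc m \<otimes> z [^] Suc m"
      using carr nat_pow_commute[of z w m] zw by (simp add: m_assoc)
    finally show ?case .
  qed (use carr in simp)
  have "(u \<otimes> w) [^] Suc n = u [^] n \<otimes> w [^] n \<otimes> (z [^] (n choose 2) \<otimes> (u \<otimes> w))"
    using carr Suc by (simp add: m_assoc)
  also have "z [^] (n choose 2) \<otimes> (u \<otimes> w) = u \<otimes> w \<otimes> z [^] (n choose 2)"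
    using carr zu zw by (intro nat_pow_commute) (simp_all add: m_assoc[symmetric], simp add: m_assoc)
  also have "u [^] n \<otimes> w [^] n \<otimes> (u \<otimes> w \<otimes> z [^] (n choose 2))
      = u [^] n \<otimes> (w [^] n \<otimes> u) \<otimes> w \<otimes> z [^] (n choose 2)"
    using carr by (simp add: m_assoc)
  also have "\<dots> = u [^] Suc n \<otimes> w [^] n \<otimes> (z [^] n \<otimes> w) \<otimes> z [^] (n choose 2)"
    using carr wnu by (simp add: m_assoc)
  also have "\<dots> = u [^] Suc n \<otimes> w [^] Suc n \<otimes> (z [^] n \<otimes> z [^] (n choose 2))"
    using carr nat_pow_commute[of z w n] zw by (simp add: m_assoc)
  also have "z [^] n \<otimes> z [^] (n choose 2) = z [^] (Suc n choose 2)"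
    using carr by (simp add: nat_pow_mult numeral_2_eq_2)
  finally show ?case .
qed (use assms in \<open>simp add: numeral_2_eq_2\<close>)

lemma (in group) nat_pow_eq_one_dvd:
  assumes "x \<in> carrier G" "x [^] (m::nat) = \<one>" "m dvd n"
  shows "x [^] n = \<one>"
  using assms by (auto simp: nat_pow_pow[symmetric])

lemma (in group) conj_nat_pow:
  assumes "a \<in> carrier G" "w \<in> carrier G"
  shows "a \<otimes> w [^] (n::nat) \<otimes> inv a = (a \<otimes> w \<otimes> inv a) [^] n"
proof (induction n)
  case (Suc n)
  have "(a \<otimes> w \<otimes> inv a) [^] Suc n = (a \<otimes> w [^] n \<otimes> inv a) \<otimes> (a \<otimes> w \<otimes> inv a)"
    using Suc by simp
  then show ?case
    using assms by (simp add: group_word)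
qed (use assms in simp)

text \<open>Conjugation by \<open>a\<close> is a homomorphism that sends \<open>w\<close> to
  \<open>[w, a]\<inverse> w\<close>, so the commutator compares \<open>w [^] n\<close> with a power
  of a product.\<close>

lemma (in group) commutator_nat_pow:
  assumes "w \<in> carrier G" "a \<in> carrier G"
  shows "commutator G (w [^] (n::nat)) a = w [^] n \<otimes> inv ((inv (commutator G w a) \<otimes> w) [^] n)"
proof -
  have "a \<otimes> inv (w [^] n) \<otimes> inv a = inv (a \<otimes> w [^] n \<otimes> inv a)"
    using assms by (simp add: group_word)
  also have "a \<otimes> w [^] n \<otimes> inv a = (a \<otimes> w \<otimes> inv a) [^] n"
    using assms(2,1) by (rule conj_nat_pow)
  also have "a \<otimes> w \<otimes> inv a = inv (commutator G w a) \<otimes> w"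
    using assms by (simp add: commutator_def group_word)
  finally show ?thesis
    using assms by (simp add: commutator_def m_assoc)
qed

lemma (in group) commutator_nat_pow_central:
  assumes "w \<in> carrier G" "a \<in> carrier G"
    and comm: "commutator G w a \<otimes> w = w \<otimes> commutator G w a"
  shows "commutator G (w [^] (n::nat)) a = commutator G w a [^] n"
proof -
  let ?c = "commutator G w a"
  have c: "?c \<in> carrier G" using assms by simp
  have "inv ?c \<otimes> w = w \<otimes> inv ?c"
    using c assms by (intro inv_commute) auto
  then have "(inv ?c \<otimes> w) [^] n = inv (?c [^] n) \<otimes> w [^] n"
    using pow_mult_distrib[of "inv ?c" w n] c assms(1) by (simp only: nat_pow_inv inv_closed)
  then show ?thesis
    unfolding commutator_nat_pow[OF assms(1,2)] using c assms(1) by (simp add: group_word)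
qed

lemma odd_dvd_choose_two:
  assumes "odd (p::nat)"
  shows "p dvd p choose 2"
proof -
  obtain k where "p = 2 * k + 1" using assms oddE by blast
  then have "p choose 2 = p * k" by (simp add: choose_two algebra_simps)
  then show ?thesis by simp
qed

text \<open>By \<open>commutator_nat_pow\<close> the claim is \<open>(t\<inverse> w)^p = w^p\<close>
  for \<open>t = [w, a]\<close>. In the class-two expansion \<open>t\<inverse>\<close> and the
  correction factor contribute the powers \<open>p\<close> and \<open>p choose 2\<close>, and both
  vanish.\<close>

lemma (in group) commutator_pow_eq_one:
  assumes w: "w \<in> carrier G" and a: "a \<in> carrier G" and p: "odd (p::nat)"
    and "commutator G w a [^] p = \<one>"
    and "commutator G (commutator G w a) (inv w) [^] p = \<one>"
    and z: "\<And>x. x \<in> {w, commutator G w a} \<Longrightarrow>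
      commutator G (commutator G w a) (inv w) \<otimes> x = x \<otimes> commutator G (commutator G w a) (inv w)"
  shows "commutator G (w [^] p) a = \<one>"
proof -
  define t where "t = commutator G w a"
  \<comment> \<open>Exactly the factor with \<open>w t\<inverse> = t\<inverse> w z\<close>; this is
    why \<open>inv w\<close> occurs in the hypotheses.\<close>
  define z where "z = inv (commutator G t (inv w))"
  have carr: "t \<in> carrier G" "z \<in> carrier G" using w a by (auto simp: t_def z_def)
  have zw: "z \<otimes> w = w \<otimes> z"
    unfolding z_def using z[of w] w carr by (intro inv_commute) (auto simp: t_def)
  have "z \<otimes> t = t \<otimes> z"
    unfolding z_def using z[of t] w carr by (intro inv_commute) (auto simp: t_def)
  then have zt: "z \<otimes> inv t = inv t \<otimes> z"
    using inv_commute[of t z] carr by simp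
  have wt: "w \<otimes> inv t = inv t \<otimes> w \<otimes> z"
    using w carr by (simp add: z_def commutator_def group_word)
  have "(inv t \<otimes> w) [^] p = inv t [^] p \<otimes> w [^] p \<otimes> z [^] (p choose 2)"
    using w carr wt zt zw by (intro nat_pow_mult_class_two) auto
  also have "inv t [^] p = \<one>"
    using assms(4) carr by (simp add: t_def nat_pow_inv)
  also have "z [^] (p choose 2) = \<one>"
    using nat_pow_eq_one_dvd[OF carr(2) _ odd_dvd_choose_two[OF p]] assms(5) carr w
    by (simp add: z_def nat_pow_inv flip: t_def)
  finally have "(inv t \<otimes> w) [^] p = w [^] p"
    using w by simp
  then show ?thesis
    unfolding commutator_nat_pow[OF w a] using w by (simp flip: t_def)
qed

text \<open>Modulo \<open>M\<close> the element \<open>[[w, a], w\<inverse>]\<close> commutes with \<open>w\<close> and \<open>[w, a]\<close>, so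
  \<open>[w\<^sup>p, a]\<close> can be expanded as in a group of class two, and \<open>p\<close> divides \<open>p choose 2\<close>.\<close>

lemma (in group) commutator_subgroup_subset_of_class_two:
  assumes WA: "W \<lhd> G" "A \<lhd> G" "W \<subseteq> A" and M: "M \<lhd> G" and p: "odd (p::nat)"
    and T: "T = commutator_subgroup G W A"
    and gen: "T \<subseteq> generate G ((\<lambda>x. x [^] p) ` W \<union> L)"
    and L: "L \<subseteq> centralizer_mod G A M"
    and powT: "\<And>t. t \<in> T \<Longrightarrow> t [^] p \<in> M"
    and TAA: "commutator_subgroup G (commutator_subgroup G T A) A \<subseteq> M"
  shows "commutator_subgroup G T A \<subseteq> M"
proof -
  interpret M: normal M G by fact
  interpret q: group_hom G "G Mod M" "(#>) M" by (rule M.group_hom_Mod)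
  note carr = WA(1,2)[THEN normal_subset]
  have Tn: "T \<lhd> G" unfolding T by (intro commutator_subgroup_normal WA)
  have Tc: "T \<subseteq> carrier G" using normal_subset[OF Tn] .
  have TA: "T \<subseteq> A"
    unfolding T using carr(1) WA(2) by (rule commutator_subgroup_subset_right)
  define S where "S = commutator_subgroup G T A"
  have ST: "S \<subseteq> T"
    unfolding S_def using Tn carr(2) by (rule commutator_subgroup_subset_left)
  have "commutator G (w [^] p) a \<in> M" if w: "w \<in> W" and a: "a \<in> A" for w a
  proof -
    have wc: "w \<in> carrier G" and ac: "a \<in> carrier G" using w a carr by auto
    define t where "t = commutator G w a"
    have t: "t \<in> T" unfolding t_def T using w a by (rule commutator_in_commutator_subgroup)
    have tc: "t \<in> carrier G" using t Tc by blast
    \<comment> \<open>Here \<open>W \<subseteq> A\<close> enters: \<open>[t, w\<inverse>]\<close>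
      counts as an element of \<open>[T, A]\<close>, and its commutators with \<open>w\<close> and
      \<open>t\<close> fall into \<open>[T, A, A]\<close>.\<close>
    have wA: "inv w \<in> A" "w \<in> A"
      using w WA(3) subgroup.m_inv_closed[OF normal_imp_subgroup[OF WA(2)]] by auto
    define z where "z = commutator G t (inv w)"
    have z: "z \<in> S" unfolding z_def S_def using t wA(1) by (rule commutator_in_commutator_subgroup)
    have zc: "z \<in> carrier G" using z ST Tc by blast
    have zx: "(M #> z) \<otimes>\<^bsub>G Mod M\<^esub> (M #> x) = (M #> x) \<otimes>\<^bsub>G Mod M\<^esub> (M #> z)"
      if "x \<in> {w, t}" for x
    proof -
      have xA: "x \<in> A" using that wA t TA by blast
      have xc: "x \<in> carrier G" using xA carr by blast
      have "commutator G z x \<in> M"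
        using commutator_in_commutator_subgroup[OF z xA] TAA unfolding S_def by blast
      then show ?thesis using M.commutator_mem_iff[OF zc xc] by simp
    qed
    have t_img: "M #> t = commutator (G Mod M) (M #> w) (M #> a)"
      unfolding t_def using wc ac by (rule q.hom_commutator)
    have z_img: "M #> z = commutator (G Mod M) (M #> t) (inv\<^bsub>G Mod M\<^esub> (M #> w))"
      unfolding z_def q.hom_commutator[OF tc inv_closed[OF wc]] q.hom_inv[OF wc] ..
    have "commutator (G Mod M) ((M #> w) [^]\<^bsub>G Mod M\<^esub> p) (M #> a) = \<one>\<^bsub>G Mod M\<^esub>"
    proof (rule q.H.commutator_pow_eq_one[OF q.hom_closed[OF wc] q.hom_closed[OF ac] p],
        unfold t_img[symmetric] z_img[symmetric])
      show "(M #> t) [^]\<^bsub>G Mod M\<^esub> p = \<one>\<^bsub>G Mod M\<^esub>"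
        using M.nat_pow_mem_iff[OF tc] powT[OF t] by blast
      show "(M #> z) [^]\<^bsub>G Mod M\<^esub> p = \<one>\<^bsub>G Mod M\<^esub>"
        using M.nat_pow_mem_iff[OF zc] powT z ST by blast
      show "(M #> z) \<otimes>\<^bsub>G Mod M\<^esub> x = x \<otimes>\<^bsub>G Mod M\<^esub> (M #> z)"
        if "x \<in> {M #> w, M #> t}" for x
        using that zx by blast
    qed
    then have "M #> commutator G (w [^] p) a = \<one>\<^bsub>G Mod M\<^esub>"
      unfolding q.hom_commutator[OF nat_pow_closed[OF wc] ac] q.hom_nat_pow[OF wc] .
    then show ?thesis
      using M.coset_eq_one_iff[OF commutator_closed[OF nat_pow_closed[OF wc] ac]] by blast
  qed
  then have "(\<lambda>x. x [^] p) ` W \<union> L \<subseteq> centralizer_mod G A M"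
    using L carr by (auto simp: centralizer_mod_def)
  then have "T \<subseteq> centralizer_mod G A M"
    using gen generate_subgroup_incl[OF _ centralizer_mod_subgroup[OF carr(2) M]] by blast
  then show ?thesis
    using commutator_subgroup_subset_iff[OF Tc normal_imp_subgroup[OF M]] by blast
qed

text \<open>For \<open>W = A\<close> the last condition says that the image of \<open>W\<close>
  modulo \<open>L\<close> is powerful; for larger \<open>A\<close> it is the stronger notion of
  being powerfully embedded. The condition on orders is stated as a \<open>p\<close>-power exponent,
  which passes more easily through the step.\<close>

definition powerful_mod :: "('a, 'm) monoid_scheme \<Rightarrow> nat \<Rightarrow> 'a set \<Rightarrow> 'a set \<Rightarrow> 'a set \<Rightarrow> bool"
  where "powerful_mod G p W A L \<longleftrightarrow> finite_mod G W L \<and>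
    (\<exists>e. \<forall>w\<in>W. w [^]\<^bsub>G\<^esub> (p ^ e) \<in> L) \<and>
    commutator_subgroup G W A \<subseteq> generate G ((\<lambda>x. x [^]\<^bsub>G\<^esub> p) ` W \<union> L)"

lemma (in group) normal_generate_powers_Un:
  assumes "T \<lhd> G" "M \<lhd> G"
  shows "generate G ((\<lambda>x. x [^] (p::nat)) ` T \<union> M) \<lhd> G"
proof (rule generate_Un_normal[OF _ _ assms(2)])
  show "(\<lambda>x. x [^] p) ` T \<subseteq> carrier G"
    using normal_subset[OF assms(1)] by auto
  fix g x assume g: "g \<in> carrier G" and "x \<in> (\<lambda>x. x [^] p) ` T"
  then obtain t where t: "t \<in> T" "x = t [^] p" by blast
  have "g \<otimes> x \<otimes> inv g = (g \<otimes> t \<otimes> inv g) [^] p"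
    using t g normal_subset[OF assms(1)] conj_nat_pow[of g t p] by auto
  then show "g \<otimes> x \<otimes> inv g \<in> (\<lambda>x. x [^] p) ` T"
    using normal_invE(2)[OF assms(1) g t(1)] by blast
qed

text \<open>The preceding lemma moves the containment \<open>[T, A] \<subseteq> U\<^sub>k T\<^sup>p\<close> down the central
  series \<open>U\<^sub>k\<close> of \<open>A\<close> above \<open>K\<close>.\<close>

lemma (in group) commutator_subgroup_subset_powers:
  assumes W: "W \<lhd> G" and A: "A \<lhd> G" and WA: "W \<subseteq> A" and K: "K \<lhd> G" and p: "odd (p::nat)"
    and T: "T = commutator_subgroup G W A"
    and gen: "T \<subseteq> generate G ((\<lambda>x. x [^] p) ` W \<union> L)"
    and L: "L \<subseteq> centralizer_mod G A K"
    and nil: "(centralizer_mod G A ^^ c) K = carrier G"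
  shows "commutator_subgroup G T A \<subseteq> generate G ((\<lambda>x. x [^] p) ` T \<union> K)"
proof -
  let ?P = "(\<lambda>x. x [^] p) ` T" and ?U = "\<lambda>k. (centralizer_mod G A ^^ k) K"
  note Ac = normal_subset[OF A]
  have Tn: "T \<lhd> G" unfolding T using W A by (rule commutator_subgroup_normal)
  have Tc: "T \<subseteq> carrier G" using normal_subset[OF Tn] .
  have Sn: "commutator_subgroup G T A \<lhd> G" using Tn A by (rule commutator_subgroup_normal)
  have "commutator_subgroup G T A \<subseteq> generate G (?P \<union> ?U 0)"
  proof (rule inc_induct[of 0 c "\<lambda>k. commutator_subgroup G T A \<subseteq> generate G (?P \<union> ?U k)"])
    show "commutator_subgroup G T A \<subseteq> generate G (?P \<union> ?U c)"
      using normal_subset[OF Sn] generate.incl[of _ "?P \<union> ?U c" G] unfolding nil by blast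
  next
    fix k assume IH: "commutator_subgroup G T A \<subseteq> generate G (?P \<union> ?U (Suc k))"
    define M where "M = generate G (?P \<union> ?U k)"
    have Un: "?U k \<lhd> G" using A K by (rule centralizer_mod_funpow_normal)
    have M: "M \<lhd> G" unfolding M_def using Tn Un by (rule normal_generate_powers_Un)
    have PM: "?P \<subseteq> M" "?U k \<subseteq> M" unfolding M_def by (auto intro: generate.incl)
    have KU: "K \<subseteq> ?U j" for j
    proof (induction j)
      case (Suc j)
      then show ?case
        using subset_centralizer_mod[OF Ac centralizer_mod_funpow_normal[OF A K, of j]] by simp
    qed simp
    \<comment> \<open>\<open>A\<close> centralizes \<open>?U (Suc k)\<close> modulo
      \<open>?U k\<close>, and the powers lie in \<open>M\<close> already. Hence the containment for
      \<open>Suc k\<close> yields \<open>[T, A, A] \<subseteq> M\<close>.\<close>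
    have "?P \<union> ?U (Suc k) \<subseteq> centralizer_mod G A M"
      using PM subset_centralizer_mod[OF Ac M] centralizer_mod_mono[OF subset_refl PM(2), of G A]
      by auto
    then have "commutator_subgroup G T A \<subseteq> centralizer_mod G A M"
      using IH generate_subgroup_incl[OF _ centralizer_mod_subgroup[OF Ac M]] by blast
    then have "commutator_subgroup G (commutator_subgroup G T A) A \<subseteq> M"
      using commutator_subgroup_subset_iff[OF normal_subset[OF Sn] normal_imp_subgroup[OF M]] by blast
    moreover have "L \<subseteq> centralizer_mod G A M"
      using L KU[of k] PM(2) centralizer_mod_mono[of A A K M G] by blast
    ultimately show "commutator_subgroup G T A \<subseteq> generate G (?P \<union> ?U k)"
      using commutator_subgroup_subset_of_class_two[OF W A WA M p T gen] PM(1)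
      unfolding M_def by blast
  qed simp
  then show ?thesis by simp
qed

section \<open>Abelian quotients with finitely many generators of bounded exponent\<close>

lemma (in group) generate_commute:
  assumes "x \<in> carrier G" "F \<subseteq> carrier G" "\<And>y. y \<in> F \<Longrightarrow> x \<otimes> y = y \<otimes> x" "y \<in> generate G F"
  shows "x \<otimes> y = y \<otimes> x"
proof -
  have "F \<subseteq> centralizer_mod G {x} {\<one>}"
  proof
    fix y assume "y \<in> F"
    then show "y \<in> centralizer_mod G {x} {\<one>}"
      using assms(1-3) commutator_eq_one_iff[of y x] by (auto simp: centralizer_mod_def)
  qed
  then have "y \<in> centralizer_mod G {x} {\<one>}"
    using assms(1,4) generate_subgroup_incl[OF _ centralizer_mod_subgroup[OF _ one_is_normal]] by blast
  then show ?thesis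
    using assms(1) commutator_eq_one_iff[of y x] by (auto simp: centralizer_mod_def)
qed

text \<open>A new generator \<open>x\<close> adds only the products
  \<open>x [^] i \<otimes> y\<close> with \<open>i < q\<close> and \<open>y\<close> in the old
  subgroup; the exponent is inherited because \<open>x\<close> and \<open>y\<close> commute.\<close>

lemma (in group) finite_generate_commuting:
  assumes "finite F" "F \<subseteq> carrier G" "q > 0"
    and "\<And>x y. x \<in> F \<Longrightarrow> y \<in> F \<Longrightarrow> x \<otimes> y = y \<otimes> x"
    and "\<And>x. x \<in> F \<Longrightarrow> x [^] (q::nat) = \<one>"
  shows "finite (generate G F) \<and> (\<forall>y\<in>generate G F. y [^] q = \<one>)"
  using assms(1,2,4,5)
proof (induction F)
  case (insert x F)
  let ?D = "generate G F"
  have xc: "x \<in> carrier G" and Fc: "F \<subseteq> carrier G" using insert.prems(1) by auto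
  have D: "finite ?D" "\<And>y. y \<in> ?D \<Longrightarrow> y [^] q = \<one>"
    using insert.IH Fc insert.prems by auto
  have Dc: "y \<in> carrier G" if "y \<in> ?D" for y using generate_in_carrier[OF Fc that] .
  have xD: "x \<otimes> y = y \<otimes> x" if "y \<in> ?D" for y
    using generate_commute[OF xc Fc _ that] insert.prems(2) by blast
  have xq: "x [^] q = \<one>" using insert.prems(3) by simp
  have E: "generate G (insert x F) \<subseteq> {x [^] (i::nat) \<otimes> y | i y. y \<in> ?D}"
  proof
    fix h assume "h \<in> generate G (insert x F)"
    then show "h \<in> {x [^] (i::nat) \<otimes> y | i y. y \<in> ?D}"
    proof (induction h rule: generate.induct)
      case one
      have "\<one> = x [^] (0::nat) \<otimes> \<one>" by simp
      then show ?case using generate.one[of G F] by blast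
    next
      case (incl h)
      then consider "h = x [^] (1::nat) \<otimes> \<one>" | "h \<in> F" "h = x [^] (0::nat) \<otimes> h"
        using xc Fc by auto
      then show ?case
        using generate.one[of G F] generate.incl[of h F G] by cases blast+
    next
      case (inv h)
      \<comment> \<open>Natural exponents suffice, because \<open>q > 0\<close> turns the inverse
        into a power.\<close>
      have "inv x = x [^] (q - 1)"
      proof (rule inv_equality)
        show "x [^] (q - 1) \<otimes> x = \<one>"
          using xq assms(3) by (simp flip: nat_pow_Suc)
      qed (use xc in auto)
      then consider "inv h = x [^] (q - 1) \<otimes> \<one>" | "h \<in> F" "inv h = x [^] (0::nat) \<otimes> inv h"
        using inv xc Fc by auto
      then show ?case
        using generate.one[of G F] generate.inv[of h F G] by cases blast+
    next
      case (eng h1 h2)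
      then obtain i j y z where h: "h1 = x [^] (i::nat) \<otimes> y" "h2 = x [^] (j::nat) \<otimes> z" "y \<in> ?D" "z \<in> ?D"
        by blast
      have "h1 \<otimes> h2 = x [^] i \<otimes> (y \<otimes> x [^] j) \<otimes> z"
        using h xc Dc by (simp add: m_assoc)
      also have "y \<otimes> x [^] j = x [^] j \<otimes> y"
        using nat_pow_commute[of x y j] xD xc h(3) Dc by simp
      also have "x [^] i \<otimes> (x [^] j \<otimes> y) \<otimes> z = x [^] (i + j) \<otimes> (y \<otimes> z)"
        using h xc Dc by (simp add: m_assoc nat_pow_mult[symmetric])
      finally show ?case using generate.eng[OF h(3,4)] by blast
    qed
  qed
  have "x [^] i = x [^] (i mod q)" for i :: nat
  proof -
    have "x [^] i = x [^] (q * (i div q)) \<otimes> x [^] (i mod q)"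
      using xc by (simp add: nat_pow_mult)
    then show ?thesis using xc xq by (simp add: nat_pow_pow[symmetric])
  qed
  then have E': "generate G (insert x F) \<subseteq> (\<lambda>(i, y). x [^] i \<otimes> y) ` ({..<q} \<times> ?D)"
    (is "_ \<subseteq> ?E'")
  proof (intro subsetI)
    fix h assume "h \<in> generate G (insert x F)"
    then obtain i y where h: "h = x [^] (i::nat) \<otimes> y" "y \<in> ?D" using E by blast
    have "h = (\<lambda>(i, y). x [^] i \<otimes> y) (i mod q, y)"
      using h(1) \<open>\<And>i. x [^] i = x [^] (i mod q)\<close>[of i] by simp
    then show "h \<in> ?E'"
      using h(2) assms(3) by (intro image_eqI[of _ _ "(i mod q, y)"]) auto
  qed
  then have "finite (generate G (insert x F))"
    using finite_subset[OF E'] D(1) by simp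
  moreover have "h [^] q = \<one>" if hg: "h \<in> generate G (insert x F)" for h
  proof -
    obtain i y where h: "h = x [^] (i::nat) \<otimes> y" "y \<in> ?D" using hg E by blast
    have "h [^] q = (x [^] i) [^] q \<otimes> y [^] q"
      unfolding h(1) using h(2) xc xD Dc nat_pow_commute[of x y i] by (intro pow_mult_distrib) auto
    also have "(x [^] i) [^] q = \<one>"
      using xc xq nat_pow_eq_one_dvd[of x q "i * q"] by (simp add: nat_pow_pow)
    finally show ?thesis using D(2) h(2) by simp
  qed
  ultimately show ?case by blast
qed (simp add: generate_empty)

text \<open>The preceding lemma in \<open>G Mod H\<close>. Adjoining \<open>H\<close> to the
  generators adds only the identity coset to the image.\<close>

lemma (in normal) finite_mod_generate_commuting:
  assumes U: "U \<subseteq> carrier G" and fin: "finite_mod G U H" and q: "(q::nat) > 0"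
    and "\<And>x y. x \<in> U \<Longrightarrow> y \<in> U \<Longrightarrow> commutator G x y \<in> H"
    and "\<And>x. x \<in> U \<Longrightarrow> x [^] q \<in> H"
  shows "finite_mod G (generate G (U \<union> H)) H \<and> (\<forall>r\<in>generate G (U \<union> H). r [^] q \<in> H)"
proof -
  interpret q: group_hom G "G Mod H" "(#>) H" by (rule group_hom_Mod)
  have UH: "U \<union> H \<subseteq> carrier G" using U subset by blast
  have comm: "commutator G x y \<in> H" if "x \<in> U \<union> H" "y \<in> U \<union> H" for x y
  proof -
    have "x \<in> carrier G" "y \<in> carrier G" using that UH by auto
    then show ?thesis
      using that assms(4)[of x y] commutator_in_normal[OF normal_axioms, of x y] by auto
  qed
  have pow: "x [^] q \<in> H" if "x \<in> U \<union> H" for x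
  proof (cases "x \<in> H")
    case True
    then have xc: "x \<in> carrier G" using subset by blast
    have 1: "H #> x = \<one>\<^bsub>G Mod H\<^esub>" using True coset_eq_one_iff[OF xc] by blast
    show ?thesis
      unfolding nat_pow_mem_iff[OF xc] 1 by (rule q.H.nat_pow_one)
  qed (use that assms(5)[of x] in auto)
  have "(#>) H ` (U \<union> H) \<subseteq> insert \<one>\<^bsub>G Mod H\<^esub> ((#>) H ` U)"
  proof
    fix c assume "c \<in> (#>) H ` (U \<union> H)"
    then obtain x where x: "x \<in> U \<union> H" "c = H #> x" by blast
    then have "x \<in> carrier G" using UH by blast
    then show "c \<in> insert \<one>\<^bsub>G Mod H\<^esub> ((#>) H ` U)"
      using x coset_eq_one_iff[of x] by blast
  qed
  then have "finite ((#>) H ` (U \<union> H))"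
    using fin finite_subset unfolding finite_mod_def by blast
  then have *: "finite (generate (G Mod H) ((#>) H ` (U \<union> H))) \<and>
      (\<forall>y\<in>generate (G Mod H) ((#>) H ` (U \<union> H)). y [^]\<^bsub>G Mod H\<^esub> q = \<one>\<^bsub>G Mod H\<^esub>)"
  proof (rule q.H.finite_generate_commuting[OF _ _ q])
    show "(#>) H ` (U \<union> H) \<subseteq> carrier (G Mod H)"
      using UH q.hom_closed by (intro image_subsetI) auto
    show "x \<otimes>\<^bsub>G Mod H\<^esub> y = y \<otimes>\<^bsub>G Mod H\<^esub> x"
      if xy: "x \<in> (#>) H ` (U \<union> H)" "y \<in> (#>) H ` (U \<union> H)" for x y
    proof -
      obtain x' y' where "x' \<in> U \<union> H" "y' \<in> U \<union> H" "x = H #> x'" "y = H #> y'"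
        using xy by blast
      then show ?thesis using commutator_mem_iff[of x' y'] comm[of x' y'] UH by blast
    qed
    show "x [^]\<^bsub>G Mod H\<^esub> q = \<one>\<^bsub>G Mod H\<^esub>" if x: "x \<in> (#>) H ` (U \<union> H)" for x
    proof -
      obtain x' where "x' \<in> U \<union> H" "x = H #> x'" using x by blast
      then show ?thesis using nat_pow_mem_iff[of x' q] pow[of x'] UH by blast
    qed
  qed
  have img: "generate (G Mod H) ((#>) H ` (U \<union> H)) = (#>) H ` generate G (U \<union> H)"
    using q.generate_img[OF UH] by simp
  have "r [^] q \<in> H" if "r \<in> generate G (U \<union> H)" for r
    using * that nat_pow_mem_iff[OF generate_in_carrier[OF UH that], of q] unfolding img by blast
  then show ?thesis using * unfolding img finite_mod_def by blast
qed

section \<open>One commutator step\<close>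

text \<open>Modulo \<open>K\<close> the value of \<open>[w, a]\<close> depends only on
  \<open>w\<close> modulo \<open>L\<close> and \<open>a\<close> modulo \<open>D\<close>, so the
  commutators of representatives exhaust all values. The second argument is replaced first.\<close>

lemma (in group) finite_mod_commutators:
  assumes W: "W \<lhd> G" and A: "A \<lhd> G" and WA: "W \<subseteq> A" and L: "L \<lhd> G" and K: "K \<lhd> G" and D: "D \<lhd> G"
    and LK: "L \<subseteq> centralizer_mod G A K"
    and DK: "\<And>w d. w \<in> W \<Longrightarrow> d \<in> D \<Longrightarrow> d \<in> A \<Longrightarrow> commutator G w d \<in> K"
    and finW: "finite_mod G W L" and finA: "finite_mod G A D"
  shows "finite_mod G {commutator G w a | w a. w \<in> W \<and> a \<in> A} K"
proof -
  interpret K: normal K G by fact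
  note Wc = normal_subset[OF W] and Ac = normal_subset[OF A]
  obtain F where F: "finite F" "F \<subseteq> W" "\<And>s. s \<in> W \<Longrightarrow> \<exists>f\<in>F. s \<otimes> inv f \<in> L"
    using normal.finite_mod_representatives[OF L finW Wc] by metis
  obtain F' where F': "finite F'" "F' \<subseteq> A" "\<And>s. s \<in> A \<Longrightarrow> \<exists>f\<in>F'. s \<otimes> inv f \<in> D"
    using normal.finite_mod_representatives[OF D finA Ac] by metis
  show ?thesis
  proof (rule K.finite_modI)
    show "finite ((\<lambda>(w, a). commutator G w a) ` (F \<times> F'))" using F(1) F'(1) by simp
    show "(\<lambda>(w, a). commutator G w a) ` (F \<times> F') \<subseteq> carrier G"
      using subset_trans[OF F(2) Wc] subset_trans[OF F'(2) Ac] by (auto intro!: commutator_closed)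
    show "{commutator G w a | w a. w \<in> W \<and> a \<in> A} \<subseteq> carrier G"
      using Wc Ac by (rule commutator_subgroup_gens_closed)
    fix s assume "s \<in> {commutator G w a | w a. w \<in> W \<and> a \<in> A}"
    then obtain w a where s: "s = commutator G w a" "w \<in> W" "a \<in> A" by blast
    obtain f where f: "f \<in> F" "w \<otimes> inv f \<in> L" using F(3)[OF s(2)] by blast
    obtain b where b: "b \<in> F'" "a \<otimes> inv b \<in> D" using F'(3)[OF s(3)] by blast
    define l where "l = w \<otimes> inv f"
    define d where "d = a \<otimes> inv b"
    have fW: "f \<in> W" and bA: "b \<in> A" using f(1) b(1) F(2) F'(2) by auto
    have dA: "d \<in> A"
      unfolding d_def using subgroup.m_closed[OF normal_imp_subgroup[OF A] s(3)]
        subgroup.m_inv_closed[OF normal_imp_subgroup[OF A] bA] by blast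
    have carr: "w \<in> carrier G" "a \<in> carrier G" "f \<in> carrier G" "b \<in> carrier G" 
      using s fW bA Wc Ac by auto
    then have ld: "l \<in> carrier G" "d \<in> carrier G" by (auto simp: l_def d_def)
    define u where "u = commutator G w b"
    define v where "v = commutator G f b"
    have uv: "u \<in> carrier G" "v \<in> carrier G" using carr by (auto simp: u_def v_def)
    have uW: "u \<in> W" unfolding u_def using commutator_in_normal(1)[OF W s(2) carr(4)] .
    have vA: "v \<in> A" unfolding v_def using commutator_in_normal(2)[OF A carr(3) bA] .
    have lK: "commutator G l x \<in> K" if "x \<in> A" for x
      using f(2) LK that unfolding l_def centralizer_mod_def by blast
    \<comment> \<open>From \<open>[w, d b] = [w, d] d [w, b] d\<inverse>\<close>. The second factor
      is in \<open>K\<close> because \<open>u\<close> is again in \<open>W\<close>.\<close>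
    have "s \<otimes> inv u = commutator G w d \<otimes> inv (commutator G u d)"
      using carr by (simp add: s(1) d_def u_def commutator_def group_word)
    moreover have "commutator G w d \<in> K" "commutator G u d \<in> K"
      using DK[of _ d] s(2) uW dA b(2) unfolding d_def by auto
    ultimately have su: "s \<otimes> inv u \<in> K" by simp
    \<comment> \<open>From \<open>[l f, b] = l [f, b] l\<inverse> [l, b]\<close>. Since
      \<open>v\<close> is in \<open>A\<close>, the element \<open>l\<close> of \<open>L\<close>
      centralizes it modulo \<open>K\<close>.\<close>
    have "u \<otimes> inv v = commutator G l v \<otimes> (v \<otimes> commutator G l b \<otimes> inv v)"
      using carr by (simp add: l_def u_def v_def commutator_def group_word)
    then have "u \<otimes> inv v \<in> K"
      using lK[OF vA] lK[OF bA] K.inv_op_closed2[OF uv(2)] by simp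
    then have "(s \<otimes> inv u) \<otimes> (u \<otimes> inv v) \<in> K" using su by simp
    moreover have "(s \<otimes> inv u) \<otimes> (u \<otimes> inv v) = s \<otimes> inv v"
      using carr uv by (simp add: s(1) group_word)
    ultimately show "\<exists>f\<in>(\<lambda>(w, a). commutator G w a) ` (F \<times> F'). s \<otimes> inv f \<in> K"
      using f(1) b(1) unfolding v_def by auto
  qed
qed

lemma (in group) normal_generate_commutators_Un:
  assumes "U \<lhd> G" "A \<lhd> G" "K \<lhd> G"
  shows "generate G ({commutator G x a | x a. x \<in> U \<and> a \<in> A} \<union> K) \<lhd> G"
  by (rule generate_Un_normal[OF commutator_subgroup_gens_closed[OF assms(1,2)[THEN normal_subset]]
        conj_commutator_gens[OF assms(1,2)] assms(3)])

text \<open>With \<open>V = [U, A]\<close>, the group \<open>V / [V, A] K\<close> is abelian and generated by finitely many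
  elements \<open>[x, a]\<close> with \<open>[x, a]\<^sup>q = [x\<^sup>q, a] = 1\<close>, where \<open>q = p\<^sup>e\<close>.\<close>

lemma (in group) finite_exponent_chain:
  assumes W: "W \<lhd> G" and A: "A \<lhd> G" and WA: "W \<subseteq> A" and K: "K \<lhd> G"
    and LK: "L \<subseteq> centralizer_mod G A K"
    and p: "(p::nat) > 0" and powW: "\<And>w. w \<in> W \<Longrightarrow> w [^] (p ^ e) \<in> L"
    and fin: "finite_mod G {commutator G w a | w a. w \<in> W \<and> a \<in> A} K"
  shows "U \<lhd> G \<Longrightarrow> U \<subseteq> W \<Longrightarrow> U \<subseteq> (centralizer_mod G A ^^ k) K \<Longrightarrow>
    finite_mod G (generate G ({commutator G x a | x a. x \<in> U \<and> a \<in> A} \<union> K)) K \<and>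
    (\<exists>e. \<forall>r \<in> generate G ({commutator G x a | x a. x \<in> U \<and> a \<in> A} \<union> K). r [^] (p ^ e) \<in> K)"
proof (induction k arbitrary: U)
  case 0
  note Ac = normal_subset[OF A]
  have "{commutator G x a | x a. x \<in> U \<and> a \<in> A} \<subseteq> K"
    using 0(3) commutator_in_normal(1)[OF K] Ac by auto
  then have R: "generate G ({commutator G x a | x a. x \<in> U \<and> a \<in> A} \<union> K) \<subseteq> K"
    by (intro generate_subgroup_incl normal_imp_subgroup[OF K]) auto
  have "finite_mod G K K"
  proof (rule normal.finite_modI[OF K, of "{\<one>}"])
    show "\<exists>f\<in>{\<one>}. s \<otimes> inv f \<in> K" if "s \<in> K" for s
      using that normal_subset[OF K] by auto
  qed (use normal_subset[OF K] in auto)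
  then have "finite_mod G (generate G ({commutator G x a | x a. x \<in> U \<and> a \<in> A} \<union> K)) K"
    by (rule finite_mod_mono[OF _ R subset_refl K K normal_subset[OF K]])
  moreover have "\<forall>r \<in> generate G ({commutator G x a | x a. x \<in> U \<and> a \<in> A} \<union> K). r [^] (p ^ 0) \<in> K"
    using R normal_subset[OF K] by (auto simp: subset_iff)
  ultimately show ?case by blast
next
  case (Suc k)
  note Wc = normal_subset[OF W] and Ac = normal_subset[OF A] and Uc = normal_subset[OF Suc.prems(1)]
  define B where "B = {commutator G x a | x a. x \<in> U \<and> a \<in> A}"
  define V where "V = commutator_subgroup G U A"
  define M where "M = generate G ({commutator G x a | x a. x \<in> V \<and> a \<in> A} \<union> K)"
  have V: "V \<lhd> G" unfolding V_def using Suc.prems(1) A by (rule commutator_subgroup_normal)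
  have M: "M \<lhd> G" unfolding M_def using V A K by (rule normal_generate_commutators_Un)
  interpret M: normal M G by fact
  interpret q: group_hom G "G Mod M" "(#>) M" by (rule M.group_hom_Mod)
  have KM: "K \<subseteq> M" unfolding M_def by (auto intro: generate.incl)
  have VU: "V \<subseteq> U" unfolding V_def using Suc.prems(1) Ac by (rule commutator_subgroup_subset_left)
  have VW: "V \<subseteq> W" using VU Suc.prems(2) by blast
  have VA: "V \<subseteq> A" using VW WA by blast
  \<comment> \<open>\<open>[U, A]\<close> lies one term lower than \<open>U\<close> in the central
    series above \<open>K\<close>, so the induction hypothesis controls
    \<open>M = [V, A] K\<close>.\<close>
  have "V \<subseteq> (centralizer_mod G A ^^ k) K"
    unfolding V_def using Suc.prems(3)
      commutator_subgroup_subset_iff[OF Uc normal_imp_subgroup[OF centralizer_mod_funpow_normal[OF A K]]]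
    by simp
  then have IH: "finite_mod G M K" "\<exists>e. \<forall>r\<in>M. r [^] (p ^ e) \<in> K"
    using Suc.IH[OF V VW] unfolding M_def by auto
  have Bc: "B \<subseteq> carrier G" unfolding B_def using Uc Ac by (rule commutator_subgroup_gens_closed)
  have BV: "b \<in> V" if "b \<in> B" for b
    using that commutator_in_commutator_subgroup[of _ U _ A] unfolding B_def V_def by auto
  have VM: "commutator G v a \<in> M" if "v \<in> V" "a \<in> A" for v a
    unfolding M_def using that by (intro generate.incl) blast
  have *: "finite_mod G (generate G (B \<union> M)) M \<and> (\<forall>r\<in>generate G (B \<union> M). r [^] (p ^ e) \<in> M)"
  proof (rule M.finite_mod_generate_commuting[OF Bc])
    show "finite_mod G B M"
    proof (rule finite_mod_mono[OF fin _ KM K M])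
      show "B \<subseteq> {commutator G w a |w a. w \<in> W \<and> a \<in> A}"
        unfolding B_def using Suc.prems(2) by blast
    qed (rule commutator_subgroup_gens_closed[OF Wc Ac])
    show "commutator G x y \<in> M" if "x \<in> B" "y \<in> B" for x y
      using VM BV VA that by auto
    fix b assume b: "b \<in> B"
    then obtain x a where xa: "b = commutator G x a" "x \<in> U" "a \<in> A" unfolding B_def by blast
    have carr: "x \<in> carrier G" "a \<in> carrier G" "b \<in> carrier G" using xa b Uc Ac Bc by auto
    have xW: "x \<in> W" "x \<in> A" using xa Suc.prems(2) WA by auto
    have b_img: "M #> b = commutator (G Mod M) (M #> x) (M #> a)"
      unfolding xa(1) using carr by (intro q.hom_commutator)
    have "commutator G (x [^] (p ^ e)) a \<in> M"
      using powW[OF xW(1)] LK xa(3) KM unfolding centralizer_mod_def by blast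
    then have "commutator (G Mod M) ((M #> x) [^]\<^bsub>G Mod M\<^esub> (p ^ e)) (M #> a) = \<one>\<^bsub>G Mod M\<^esub>"
      using M.coset_eq_one_iff[OF commutator_closed[OF nat_pow_closed[OF carr(1)] carr(2)]]
      unfolding q.hom_commutator[OF nat_pow_closed[OF carr(1)] carr(2)] q.hom_nat_pow[OF carr(1)]
      by blast
    \<comment> \<open>\<open>b\<close> is in \<open>V\<close> and \<open>x\<close> in
      \<open>A\<close>, so they commute modulo \<open>M = [V, A] K\<close>, and the power can be
      pulled out of the commutator.\<close>
    moreover have "commutator (G Mod M) ((M #> x) [^]\<^bsub>G Mod M\<^esub> (p ^ e)) (M #> a)
        = (M #> b) [^]\<^bsub>G Mod M\<^esub> (p ^ e)"
      unfolding b_img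
      using M.commutator_mem_iff[OF carr(3,1)] VM[OF BV[OF b] xW(2)] unfolding b_img
      by (intro q.H.commutator_nat_pow_central q.hom_closed carr) blast
    ultimately show "b [^] (p ^ e) \<in> M"
      using M.nat_pow_mem_iff[OF carr(3)] by blast
  qed (use p in simp)
  have R: "generate G (B \<union> K) \<subseteq> generate G (B \<union> M)"
    using KM by (intro mono_generate) auto
  have Mc: "B \<union> M \<subseteq> carrier G" using Bc normal_subset[OF M] by auto
  have "finite_mod G (generate G (B \<union> M)) K"
    by (rule finite_mod_trans[OF conjunct1[OF *] IH(1) M K generate_incl[OF Mc]])
  then have "finite_mod G (generate G (B \<union> K)) K"
    by (rule finite_mod_mono[OF _ R subset_refl K K generate_incl[OF Mc]])
  moreover obtain e' where e': "\<And>r. r \<in> M \<Longrightarrow> r [^] (p ^ e') \<in> K" using IH(2) by blast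
  have "r [^] (p ^ (e + e')) \<in> K" if "r \<in> generate G (B \<union> K)" for r
  proof -
    have rc: "r \<in> carrier G" using that R generate_incl[OF Mc] by blast
    have "(r [^] (p ^ e)) [^] (p ^ e') \<in> K"
      using * R that e' by blast
    then show ?thesis using rc by (simp add: nat_pow_pow power_add)
  qed
  ultimately show ?case unfolding B_def by blast
qed

text \<open>The subgroup \<open>D\<close> only serves to make the set of commutators finite modulo \<open>K\<close>: it has
  finite index in \<open>A\<close> and centralizes \<open>W\<close> modulo \<open>K\<close>.\<close>

lemma (in group) powerful_mod_commutator_subgroup:
  assumes W: "W \<lhd> G" and A: "A \<lhd> G" and WA: "W \<subseteq> A" and L: "L \<lhd> G" and K: "K \<lhd> G" and D: "D \<lhd> G"
    and pw: "powerful_mod G p W A L" and p: "odd p"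
    and LK: "L \<subseteq> centralizer_mod G A K"
    and nil: "(centralizer_mod G A ^^ c) K = carrier G"
    and finA: "finite_mod G A D"
    and DK: "\<And>w d. w \<in> W \<Longrightarrow> d \<in> D \<Longrightarrow> d \<in> A \<Longrightarrow> commutator G w d \<in> K"
  shows "powerful_mod G p (commutator_subgroup G W A) A K"
proof -
  obtain e where e: "\<And>w. w \<in> W \<Longrightarrow> w [^] (p ^ e) \<in> L"
    using pw unfolding powerful_mod_def by blast
  have p0: "p > 0" using p by (cases p) auto
  have fin: "finite_mod G {commutator G w a | w a. w \<in> W \<and> a \<in> A} K"
    using pw by (intro finite_mod_commutators[OF W A WA L K D LK DK _ finA]) (auto simp: powerful_mod_def)
  have Wc: "W \<subseteq> (centralizer_mod G A ^^ c) K"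
    unfolding nil by (rule normal_subset[OF W])
  note chain = finite_exponent_chain[OF W A WA K LK p0 e fin W subset_refl Wc]
  have T: "commutator_subgroup G W A \<subseteq> generate G ({commutator G x a | x a. x \<in> W \<and> a \<in> A} \<union> K)"
    unfolding commutator_subgroup_def by (intro mono_generate) auto
  have Rc: "generate G ({commutator G x a | x a. x \<in> W \<and> a \<in> A} \<union> K) \<subseteq> carrier G"
    using normal_subset[OF normal_generate_commutators_Un[OF W A K]] .
  have "finite_mod G (commutator_subgroup G W A) K"
    by (rule finite_mod_mono[OF conjunct1[OF chain] T subset_refl K K Rc])
  moreover have "\<exists>e. \<forall>t\<in>commutator_subgroup G W A. t [^] (p ^ e) \<in> K"
  proof -
    obtain e' where "\<And>r. r \<in> generate G ({commutator G x a | x a. x \<in> W \<and> a \<in> A} \<union> K) \<Longrightarrow> r [^] (p ^ e') \<in> K"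
      using chain by auto
    then show ?thesis using subsetD[OF T] by blast
  qed
  moreover have "commutator_subgroup G (commutator_subgroup G W A) A \<subseteq>
      generate G ((\<lambda>x. x [^] p) ` commutator_subgroup G W A \<union> K)"
    using pw by (intro commutator_subgroup_subset_powers[OF W A WA K p refl _ LK nil]) (auto simp: powerful_mod_def)
  ultimately show ?thesis unfolding powerful_mod_def by blast
qed

section \<open>The lower and upper central series\<close>

text \<open>With \<open>u = [h, z]\<close> and \<open>v = [x, z]\<close>, both \<open>x h\<close>
  and \<open>h x\<close> conjugate \<open>z\<close> to \<open>u v z\<close>. Hence
  \<open>(h x)\<inverse> (x h) = [x\<inverse>, h\<inverse>]\<close> centralizes
  \<open>z\<close>.\<close>

lemma (in group) commutator_commute_of_hall_witt:
  assumes carr: "x \<in> carrier G" "h \<in> carrier G" "z \<in> carrier G"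
    and "x \<otimes> commutator G h z = commutator G h z \<otimes> x"
    and "h \<otimes> commutator G x z = commutator G x z \<otimes> h"
    and "commutator G h z \<otimes> commutator G x z = commutator G x z \<otimes> commutator G h z"
  shows "commutator G (inv x) (inv h) \<otimes> z = z \<otimes> commutator G (inv x) (inv h)"
proof -
  define u where "u = commutator G h z"
  define v where "v = commutator G x z"
  have uv: "u \<in> carrier G" "v \<in> carrier G" using carr by (auto simp: u_def v_def)
  have hz: "h \<otimes> z = u \<otimes> (z \<otimes> h)" and xz: "x \<otimes> z = v \<otimes> (z \<otimes> x)"
    using carr by (simp_all add: u_def v_def commutator_def group_word)
  have xu: "x \<otimes> u = u \<otimes> x" and hv: "h \<otimes> v = v \<otimes> h" and comm: "u \<otimes> v = v \<otimes> u"
    using assms(4-6) by (simp_all add: u_def v_def)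
  have "x \<otimes> h \<otimes> z = x \<otimes> u \<otimes> (z \<otimes> h)"
    using carr uv hz by (simp add: m_assoc)
  also have "\<dots> = u \<otimes> (x \<otimes> z) \<otimes> h"
    unfolding xu using carr uv by (simp add: m_assoc)
  also have "\<dots> = (u \<otimes> v \<otimes> z) \<otimes> (x \<otimes> h)"
    unfolding xz using carr uv by (simp add: m_assoc)
  finally have 1: "x \<otimes> h \<otimes> z = (u \<otimes> v \<otimes> z) \<otimes> (x \<otimes> h)" .
  have "h \<otimes> x \<otimes> z = h \<otimes> v \<otimes> (z \<otimes> x)"
    using carr uv xz by (simp add: m_assoc)
  also have "\<dots> = v \<otimes> (h \<otimes> z) \<otimes> x"
    unfolding hv using carr uv by (simp add: m_assoc)
  also have "\<dots> = (v \<otimes> u \<otimes> z) \<otimes> (h \<otimes> x)"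
    unfolding hz using carr uv by (simp add: m_assoc)
  finally have 2: "h \<otimes> x \<otimes> z = (u \<otimes> v \<otimes> z) \<otimes> (h \<otimes> x)"
    unfolding comm .
  have "commutator G (inv x) (inv h) \<otimes> z = inv (h \<otimes> x) \<otimes> (x \<otimes> h \<otimes> z)"
    using carr by (simp add: commutator_def group_word)
  also have "\<dots> = inv (h \<otimes> x) \<otimes> (u \<otimes> v \<otimes> z) \<otimes> (x \<otimes> h)"
    unfolding 1 using carr uv by (simp add: m_assoc)
  also have "inv (h \<otimes> x) \<otimes> (u \<otimes> v \<otimes> z) = z \<otimes> inv (h \<otimes> x)"
  proof -
    have "inv (h \<otimes> x) \<otimes> (u \<otimes> v \<otimes> z) = inv (h \<otimes> x) \<otimes> ((u \<otimes> v \<otimes> z) \<otimes> (h \<otimes> x)) \<otimes> inv (h \<otimes> x)"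
      using carr uv by (simp add: group_word)
    also have "\<dots> = z \<otimes> inv (h \<otimes> x)"
      unfolding 2[symmetric] using carr by (simp add: group_word)
    finally show ?thesis .
  qed
  also have "z \<otimes> inv (h \<otimes> x) \<otimes> (x \<otimes> h) = z \<otimes> commutator G (inv x) (inv h)"
    using carr by (simp add: commutator_def group_word)
  finally show ?thesis .
qed

text \<open>The three subgroups lemma modulo \<open>M\<close>, with hypotheses on elements only;
  \<open>Z\<close> may be any set.\<close>

lemma (in group) three_subgroups:
  assumes U: "U \<lhd> G" and V: "V \<lhd> G" and Z: "Z \<subseteq> carrier G" and M: "M \<lhd> G"
    and UVZ: "\<And>x h z. x \<in> U \<Longrightarrow> h \<in> V \<Longrightarrow> z \<in> Z \<Longrightarrow> commutator G x (commutator G h z) \<in> M"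
    and VUZ: "\<And>x h z. x \<in> U \<Longrightarrow> h \<in> V \<Longrightarrow> z \<in> Z \<Longrightarrow> commutator G h (commutator G x z) \<in> M"
  shows "commutator_subgroup G U V \<subseteq> centralizer_mod G Z M"
proof (rule commutator_subgroup_subset[OF centralizer_mod_subgroup[OF Z M]])
  interpret M: normal M G by fact
  interpret q: group_hom G "G Mod M" "(#>) M" by (rule M.group_hom_Mod)
  note qcomm = q.hom_commutator
  fix x h assume x: "x \<in> U" and h: "h \<in> V"
  have carr: "x \<in> carrier G" "h \<in> carrier G"
    using x h U[THEN normal_subset] V[THEN normal_subset] by auto
  have "commutator G (commutator G x h) z \<in> M" if z: "z \<in> Z" for z
  proof -
    have zc: "z \<in> carrier G" using z Z by blast
    \<comment> \<open>The commuting lemma speaks about the commutator of inverses, so it is applied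
      to \<open>inv x\<close> and \<open>inv h\<close>.\<close>
    have x': "inv x \<in> U" "inv x \<in> carrier G"
      using x carr subgroup.m_inv_closed[OF normal_imp_subgroup[OF U]] by auto
    have h': "inv h \<in> V" "inv h \<in> carrier G"
      using h carr subgroup.m_inv_closed[OF normal_imp_subgroup[OF V]] by auto
    define u where "u = commutator G (inv h) z"
    define v where "v = commutator G (inv x) z"
    have uv: "u \<in> carrier G" "v \<in> carrier G" using x' h' zc by (auto simp: u_def v_def)
    have uU: "v \<in> U" unfolding v_def using commutator_in_normal(1)[OF U x'(1) zc] .
    have imgs: "M #> u = commutator (G Mod M) (M #> inv h) (M #> z)"
      "M #> v = commutator (G Mod M) (M #> inv x) (M #> z)"
      unfolding u_def v_def using x' h' zc by (auto intro!: qcomm)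
    have "commutator (G Mod M) (inv\<^bsub>G Mod M\<^esub> (M #> inv x)) (inv\<^bsub>G Mod M\<^esub> (M #> inv h)) \<otimes>\<^bsub>G Mod M\<^esub> (M #> z)
       = (M #> z) \<otimes>\<^bsub>G Mod M\<^esub> commutator (G Mod M) (inv\<^bsub>G Mod M\<^esub> (M #> inv x)) (inv\<^bsub>G Mod M\<^esub> (M #> inv h))"
    proof (rule q.H.commutator_commute_of_hall_witt, unfold imgs[symmetric])
      show "(M #> inv x) \<otimes>\<^bsub>G Mod M\<^esub> (M #> u) = (M #> u) \<otimes>\<^bsub>G Mod M\<^esub> (M #> inv x)"
        using M.commutator_mem_iff[OF x'(2) uv(1)] UVZ[OF x'(1) h'(1) z] unfolding u_def by blast
      show "(M #> inv h) \<otimes>\<^bsub>G Mod M\<^esub> (M #> v) = (M #> v) \<otimes>\<^bsub>G Mod M\<^esub> (M #> inv h)"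
        using M.commutator_mem_iff[OF h'(2) uv(2)] VUZ[OF x'(1) h'(1) z] unfolding v_def by blast
      \<comment> \<open>\<open>v\<close> is in \<open>U\<close> by normality, so the first
        hypothesis applies with \<open>v\<close> in place of \<open>x\<close>.\<close>
      have "commutator G v u \<in> M" using UVZ[OF uU h'(1) z] unfolding u_def .
      then show "(M #> u) \<otimes>\<^bsub>G Mod M\<^esub> (M #> v) = (M #> v) \<otimes>\<^bsub>G Mod M\<^esub> (M #> u)"
        using M.commutator_mem_iff[OF uv(2,1)] by simp
    qed (use q.hom_closed x' h' zc in auto)
    moreover have "inv\<^bsub>G Mod M\<^esub> (M #> inv x) = M #> x" "inv\<^bsub>G Mod M\<^esub> (M #> inv h) = M #> h"
      using q.hom_inv[OF x'(2)] q.hom_inv[OF h'(2)] carr by auto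
    ultimately have "commutator (G Mod M) (M #> x) (M #> h) \<otimes>\<^bsub>G Mod M\<^esub> (M #> z)
       = (M #> z) \<otimes>\<^bsub>G Mod M\<^esub> commutator (G Mod M) (M #> x) (M #> h)"
      by argo
    then show ?thesis
      unfolding M.commutator_mem_iff[OF commutator_closed[OF carr] zc] qcomm[OF carr] .
  qed
  then show "commutator G x h \<in> centralizer_mod G Z M"
    using carr by (simp add: centralizer_mod_def)
qed

text \<open>Makes the upper central series an instance of the iterated centralizers that express
  nilpotent action.\<close>

lemma (in group) upper_central_eq_funpow:
  "upper_central G n = (centralizer_mod G (carrier G) ^^ n) {\<one>}"
proof (induction n)
  case (Suc n)
  define Z where "Z = upper_central G n"
  have "Z \<lhd> G"
    unfolding Z_def Suc by (rule centralizer_mod_funpow_normal[OF normal_self one_is_normal])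
  then interpret Z: normal Z G .
  have "Z #> g \<in> group_center (G Mod Z) \<longleftrightarrow> (\<forall>x\<in>carrier G. commutator G g x \<in> Z)"
    if g: "g \<in> carrier G" for g
  proof -
    have "carrier (G Mod Z) = (#>) Z ` carrier G"
      by (auto simp: FactGroup_def RCOSETS_def)
    then have "Z #> g \<in> group_center (G Mod Z) \<longleftrightarrow> (\<forall>x\<in>carrier G.
        (Z #> g) \<otimes>\<^bsub>G Mod Z\<^esub> (Z #> x) = (Z #> x) \<otimes>\<^bsub>G Mod Z\<^esub> (Z #> g))"
      using g by (simp add: group_center_def)
    also have "\<dots> \<longleftrightarrow> (\<forall>x\<in>carrier G. commutator G g x \<in> Z)"
      using Z.commutator_mem_iff[OF g] by (intro ball_cong refl) blast
    finally show ?thesis .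
  qed
  then have "upper_central G (Suc n) = centralizer_mod G (carrier G) Z"
    unfolding upper_central.simps Z_def[symmetric] centralizer_mod_def
    by (intro Collect_cong conj_cong refl) blast
  then show ?case
    unfolding Z_def Suc by simp
qed simp

lemma (in group) upper_central_normal: "upper_central G n \<lhd> G"
  unfolding upper_central_eq_funpow by (rule centralizer_mod_funpow_normal[OF normal_self one_is_normal])

lemma (in group) upper_central_Suc:
  "upper_central G (Suc n) = centralizer_mod G (carrier G) (upper_central G n)"
  unfolding upper_central_eq_funpow by simp

lemma lower_central_Suc_0: "lower_central G (Suc 0) = carrier G"
  by (simp add: lower_central_def)

lemma lower_central_Suc_Suc:
  "lower_central G (Suc (Suc n)) = commutator_subgroup G (lower_central G (Suc n)) (carrier G)"
  by (simp add: lower_central_def)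

lemma (in group) lower_central_normal: "lower_central G (Suc n) \<lhd> G"
proof (induction n)
  case (Suc n)
  then show ?case
    unfolding lower_central_Suc_Suc[of G n] by (intro commutator_subgroup_normal normal_self)
qed (simp add: lower_central_Suc_0 normal_self)

text \<open>Three subgroups, by induction on \<open>i\<close>: one of \<open>[x, [h, z]]\<close> and
  \<open>[h, [x, z]]\<close> uses the induction hypothesis at \<open>j\<close>, the other at
  \<open>Suc j\<close>, so \<open>j\<close> must vary.\<close>

lemma (in group) lower_central_centralizes_upper_central:
  "lower_central G (Suc i) \<subseteq> centralizer_mod G (upper_central G (j + Suc i)) (upper_central G j)"
proof (induction i arbitrary: j)
  case 0
  have "commutator G x z \<in> upper_central G j" if "x \<in> carrier G" "z \<in> upper_central G (Suc j)" for x z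
  proof -
    have z: "z \<in> carrier G" "commutator G z x \<in> upper_central G j"
      using that unfolding upper_central_Suc[of j] centralizer_mod_def by auto
    have "inv (commutator G z x) \<in> upper_central G j"
      using subgroup.m_inv_closed[OF normal_imp_subgroup[OF upper_central_normal] z(2)] .
    then show ?thesis using inv_commutator[OF z(1) that(1)] by simp
  qed
  then show ?case
    unfolding lower_central_Suc_0 by (auto simp: centralizer_mod_def simp del: upper_central.simps)
next
  case (Suc i)
  have memD: "commutator G x z \<in> upper_central G k"
    if "x \<in> lower_central G (Suc i)" "z \<in> upper_central G (k + Suc i)" for x z k
    using Suc.IH[of k] that unfolding centralizer_mod_def by blast
  show ?case
    unfolding lower_central_Suc_Suc[of G i]
  proof (rule three_subgroups[OF lower_central_normal normal_self normal_subset[OF upper_central_normal]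
        upper_central_normal])
    fix x h z
    assume x: "x \<in> lower_central G (Suc i)" and h: "h \<in> carrier G"
      and z: "z \<in> upper_central G (j + Suc (Suc i))"
    have z': "z \<in> upper_central G (Suc (j + Suc i))" using z by (simp del: upper_central.simps)
    then have zc: "z \<in> carrier G" "commutator G z h \<in> upper_central G (j + Suc i)"
      using h unfolding upper_central_Suc[of "j + Suc i"] centralizer_mod_def by auto
    then have "commutator G h z \<in> upper_central G (j + Suc i)"
      using subgroup.m_inv_closed[OF normal_imp_subgroup[OF upper_central_normal] zc(2)]
        inv_commutator[OF zc(1) h] by simp
    then show "commutator G x (commutator G h z) \<in> upper_central G j"
      using memD[OF x] by blast
    have xz: "commutator G x z \<in> upper_central G (Suc j)"
      using memD[OF x, of z "Suc j"] z' by (simp del: upper_central.simps)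
    then have xz': "commutator G x z \<in> carrier G" "commutator G (commutator G x z) h \<in> upper_central G j"
      using h unfolding upper_central_Suc[of j] centralizer_mod_def by auto
    show "commutator G h (commutator G x z) \<in> upper_central G j"
      using subgroup.m_inv_closed[OF normal_imp_subgroup[OF upper_central_normal] xz'(2)]
        inv_commutator[OF xz'(1) h] by simp
  qed
qed

lemma (in group) funpow_centralizer_mod_top_mono:
  assumes "(centralizer_mod G A ^^ c) M = carrier G" "B \<lhd> G" "B \<subseteq> A" "M \<subseteq> M'" "M' \<lhd> G"
  shows "(centralizer_mod G B ^^ c) M' = carrier G"
proof
  show "(centralizer_mod G B ^^ c) M' \<subseteq> carrier G"
    by (rule normal_subset[OF centralizer_mod_funpow_normal[OF assms(2,5)]])
  show "carrier G \<subseteq> (centralizer_mod G B ^^ c) M'"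
    using centralizer_mod_funpow_mono[OF assms(3,4), where n = c and G = G] unfolding assms(1) .
qed

text \<open>The whole group is known to be finite only modulo \<open>upper_central G n\<close>. This
  subgroup serves as \<open>D\<close> at every stage, since the lower central term centralizes it
  modulo the next modulus.\<close>

lemma (in group) powerful_mod_lower_central:
  assumes pw: "powerful_mod G p (carrier G) (carrier G) (upper_central G n)" and p: "odd p"
    and nil: "(centralizer_mod G (carrier G) ^^ c) (upper_central G n) = carrier G"
  shows "i \<le> n \<Longrightarrow> powerful_mod G p (lower_central G (Suc i)) (carrier G) (upper_central G (n - i))"
proof (induction i)
  case 0
  then show ?case using pw by (simp add: lower_central_Suc_0)
next
  case (Suc i)
  define j where "j = n - Suc i"
  have j: "n - i = Suc j" "n = j + Suc i" using Suc.prems by (auto simp: j_def)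
  \<comment> \<open>\<open>n\<close> steps lead from the trivial subgroup to
    \<open>upper_central G n\<close> and \<open>c\<close> more to the top; by monotonicity
    \<open>c + n\<close> steps suffice above every \<open>upper_central G j\<close>.\<close>
  have "(centralizer_mod G (carrier G) ^^ (c + n)) {\<one>} = carrier G"
    using nil unfolding upper_central_eq_funpow funpow_add by simp
  moreover have "{\<one>} \<subseteq> upper_central G j"
    using subgroup.one_closed[OF normal_imp_subgroup[OF upper_central_normal]] by simp
  ultimately have nil': "(centralizer_mod G (carrier G) ^^ (c + n)) (upper_central G j) = carrier G"
    by (intro funpow_centralizer_mod_top_mono[OF _ normal_self subset_refl _ upper_central_normal])
  have IH: "powerful_mod G p (lower_central G (Suc i)) (carrier G) (upper_central G (Suc j))"
    using Suc j(1) by simp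
  have "commutator G w d \<in> upper_central G j"
    if "w \<in> lower_central G (Suc i)" "d \<in> upper_central G n" for w d
    using lower_central_centralizes_upper_central[of i j] that unfolding j(2)[symmetric] centralizer_mod_def
    by blast
  moreover have "finite_mod G (carrier G) (upper_central G n)"
    using pw unfolding powerful_mod_def by blast
  ultimately show ?case
    unfolding lower_central_Suc_Suc[of G i] j_def[symmetric]
    by (intro powerful_mod_commutator_subgroup[OF lower_central_normal normal_self
          normal_subset[OF lower_central_normal] upper_central_normal upper_central_normal
          upper_central_normal IH p eq_refl[OF upper_central_Suc] nil'])
qed

section \<open>The derived series\<close>

text \<open>A recursive form of \<open>derived_center\<close> that starts the derived series at \<open>W\<close>.\<close>

primrec derived_centralizer :: "('a, 'm) monoid_scheme \<Rightarrow> 'a set \<Rightarrow> nat \<Rightarrow> 'a set"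
  where
    "derived_centralizer G W 0 = {\<one>\<^bsub>G\<^esub>}"
  | "derived_centralizer G W (Suc n) =
      centralizer_mod G W (derived_centralizer G (commutator_subgroup G W W) n)"

lemma (in group) derived_centralizer_normal:
  "W \<lhd> G \<Longrightarrow> derived_centralizer G W n \<lhd> G"
proof (induction n arbitrary: W)
  case (Suc n)
  show ?case
    unfolding derived_centralizer.simps
    by (rule centralizer_mod_normal[OF Suc.prems Suc.IH[OF commutator_subgroup_normal[OF Suc.prems Suc.prems]]])
qed (simp add: one_is_normal)

text \<open>Removing the head \<open>x\<close> of the list turns \<open>h\<close> into
  \<open>[h, x]\<close> and \<open>W\<close> into \<open>[W, W]\<close>, which is one unfolding of
  \<open>derived_centralizer\<close>.\<close>

lemma (in group) foldl_commutator_subset_derived_centralizer: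
  assumes "h \<in> carrier G" "W \<lhd> G"
    and "\<And>xs. length xs = n \<Longrightarrow> (\<And>i. i < n \<Longrightarrow> xs ! i \<in> (derived G ^^ i) W) \<Longrightarrow>
      foldl (commutator G) h xs = \<one>"
  shows "h \<in> derived_centralizer G W n"
  using assms
proof (induction n arbitrary: h W)
  case 0
  then show ?case by simp
next
  case (Suc n)
  have "commutator G h x \<in> derived_centralizer G (commutator_subgroup G W W) n" if x: "x \<in> W" for x
  proof (rule Suc.IH)
    show "commutator G h x \<in> carrier G"
      using Suc.prems(1,2) x normal_subset by auto
    show "commutator_subgroup G W W \<lhd> G"
      using commutator_subgroup_normal[OF Suc.prems(2) Suc.prems(2)] .
    fix xs :: "'a list"
    assume len: "length xs = n"
      and xs: "\<And>i. i < n \<Longrightarrow> xs ! i \<in> (derived G ^^ i) (commutator_subgroup G W W)"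
    have "(x # xs) ! i \<in> (derived G ^^ i) W" if "i < Suc n" for i
    proof (cases i)
      case (Suc j)
      then have "xs ! j \<in> (derived G ^^ j) (derived G W)"
        using xs[of j] that unfolding derived_eq_commutator_subgroup by simp
      then show ?thesis
        unfolding Suc funpow_Suc_right by simp
    qed (use x in simp)
    then show "foldl (commutator G) (commutator G h x) xs = \<one>"
      using Suc.prems(3)[of "x # xs"] len by simp
  qed
  then show ?case
    using Suc.prems(1) by (simp add: centralizer_mod_def)
qed

lemma (in group) derived_center_subset:
  "derived_center G n \<subseteq> derived_centralizer G (carrier G) n"
proof
  fix h assume h: "h \<in> derived_center G n"
  show "h \<in> derived_centralizer G (carrier G) n"
  proof (rule foldl_commutator_subset_derived_centralizer[OF _ normal_self])
    show "h \<in> carrier G" using h by (simp add: derived_center_def)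
    fix xs :: "'a list"
    assume len: "length xs = n" and xs: "\<And>i. i < n \<Longrightarrow> xs ! i \<in> (derived G ^^ i) (carrier G)"
    have "xs ! (i - 1) \<in> derived_series G i" if "i \<in> {1..n}" for i
      using xs[of "i - 1"] that by (auto simp: derived_series_def)
    then show "foldl (commutator G) h xs = \<one>"
      using h len by (simp add: derived_center_def)
  qed
qed

text \<open>Each round replaces \<open>W\<close> by \<open>[W, W]\<close> and \<open>L\<close> by
  \<open>K\<close>, and raises \<open>c\<close> by one; at \<open>n = 0\<close> the bound on
  \<open>L\<close> makes it trivial. As the acting group is \<open>W\<close> itself,
  \<open>[w, d]\<close> is the inverse of \<open>[d, w]\<close>, so \<open>L\<close> can serve as
  \<open>D\<close>.\<close>

lemma (in group) powerful_mod_derived_series: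
  assumes "W \<lhd> G" "L \<lhd> G" "powerful_mod G p W W L" "odd p"
    and "(centralizer_mod G W ^^ c) L = carrier G" "L \<subseteq> derived_centralizer G W n"
  shows "powerful_mod G p ((derived G ^^ n) W) ((derived G ^^ n) W) {\<one>}"
  using assms
proof (induction n arbitrary: W L c)
  case 0
  have "L = {\<one>}"
    using 0(6) subgroup.one_closed[OF normal_imp_subgroup[OF 0(2)]] by auto
  then show ?case using 0(3) by simp
next
  case (Suc n)
  note W = Suc.prems(1) and L = Suc.prems(2) and pw = Suc.prems(3)
  define V where "V = commutator_subgroup G W W"
  define K where "K = L \<inter> derived_centralizer G V n"
  have V: "V \<lhd> G" unfolding V_def using W W by (rule commutator_subgroup_normal)
  have VW: "V \<subseteq> W"
    unfolding V_def using W normal_subset[OF W] by (rule commutator_subgroup_subset_left)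
  have K: "K \<lhd> G"
    unfolding K_def using L derived_centralizer_normal[OF V] by (rule normal_subgroup_intersect)
  have LK: "L \<subseteq> centralizer_mod G W K"
    using Suc.prems(6) commutator_in_normal(1)[OF L] normal_subset[OF W]
    by (auto simp: K_def V_def centralizer_mod_def)
  have "(centralizer_mod G W ^^ c) L \<subseteq> (centralizer_mod G W ^^ c) (centralizer_mod G W K)"
    using LK by (intro centralizer_mod_funpow_mono subset_refl)
  then have "(centralizer_mod G W ^^ Suc c) K = carrier G"
    using Suc.prems(5) normal_subset[OF centralizer_mod_funpow_normal[OF W K, of "Suc c"]]
    unfolding funpow_Suc_right by auto
  note nil = this funpow_centralizer_mod_top_mono[OF this V VW subset_refl K]
  have DK: "commutator G w d \<in> K" if "w \<in> W" "d \<in> L" "d \<in> W" for w d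
  proof -
    have carr: "d \<in> carrier G" "w \<in> carrier G" using that W[THEN normal_subset] by auto
    have "commutator G d w \<in> K" using LK that unfolding centralizer_mod_def by auto
    then show ?thesis
      using subgroup.m_inv_closed[OF normal_imp_subgroup[OF K]] inv_commutator[OF carr] by metis
  qed
  have fin: "finite_mod G W L" using pw unfolding powerful_mod_def by simp
  have "powerful_mod G p V W K"
    unfolding V_def using fin DK
    by (rule powerful_mod_commutator_subgroup[OF W W subset_refl L K L pw Suc.prems(4) LK nil(1)])
  \<comment> \<open>The next round acts with \<open>V\<close>. Shrinking the acting group affects
    only the commutator condition.\<close>
  then have "powerful_mod G p V V K"
    using commutator_subgroup_mono[OF subset_refl VW, of V] unfolding powerful_mod_def by blast
  then have "powerful_mod G p ((derived G ^^ n) V) ((derived G ^^ n) V) {\<one>}"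
    by (rule Suc.IH[OF V K _ Suc.prems(4) nil(2)]) (simp add: K_def)
  then show ?case
    unfolding funpow_Suc_right V_def derived_eq_commutator_subgroup[of G W, symmetric] by simp
qed

section \<open>Finite \<open>p\<close>-groups\<close>

text \<open>Cauchy's theorem, obtained from Sylow with exponent 1: a prime \<open>q\<close> dividing
  the order gives a nontrivial element whose order divides both \<open>q\<close> and
  \<open>p ^ e\<close>.\<close>

lemma (in group) finite_p_group_of_exponent:
  assumes p: "Factorial_Ring.prime p" and fin: "finite (carrier G)"
    and e: "\<And>x. x \<in> carrier G \<Longrightarrow> x [^] (p ^ e) = \<one>"
  shows "finite_p_group p G"
proof -
  have "order G > 0" using fin order_gt_0_iff_finite by blast
  have "q = p" if q: "Factorial_Ring.prime q" "q dvd order G" for q :: nat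
  proof -
    obtain m where "order G = q ^ 1 * m" using q(2) by auto
    then obtain S where S: "subgroup S G" "card S = q"
      using sylow_thm[OF q(1) group_axioms _ fin, of 1 m] by auto
    have "S \<noteq> {\<one>}" using S(2) q(1) by auto
    then obtain x where x: "x \<in> S" "x \<noteq> \<one>"
      using subgroup.one_closed[OF S(1)] by blast
    have xc: "x \<in> carrier G" using subgroup.mem_carrier[OF S(1) x(1)] .
    have "x [^]\<^bsub>G\<lparr>carrier := S\<rparr>\<^esub> order (G\<lparr>carrier := S\<rparr>) = \<one>\<^bsub>G\<lparr>carrier := S\<rparr>\<^esub>"
      using x(1) by (intro group.pow_order_eq_1 subgroup_imp_group[OF S(1)]) simp
    then have "x [^] q = \<one>"
      using S(2) by (simp add: order_def flip: nat_pow_consistent)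
    then have "ord x dvd q" "ord x dvd p ^ e" using e[OF xc] xc by (simp_all add: pow_eq_id)
    moreover have "ord x \<noteq> 1" using x(2) ord_eq_1[OF xc] by blast
    ultimately have "q dvd p ^ e" using q(1) prime_nat_iff by metis
    then have "q dvd p" using q(1) prime_dvd_power by blast
    then show ?thesis using q(1) p primes_dvd_imp_eq by blast
  qed
  note only_p = this
  obtain m where m: "order G = p ^ multiplicity p (order G) * m" "\<not> p dvd m"
    using multiplicity_decompose'[of "order G" p] \<open>order G > 0\<close> not_prime_unit[of p] p by blast
  have "m = 1"
  proof (rule ccontr)
    assume "m \<noteq> 1"
    then obtain q where q: "Factorial_Ring.prime q" "q dvd m" using prime_factor_nat by blast
    then have "q dvd order G" by (subst m(1)) simp
    then show False using only_p[OF q(1)] q(2) m(2) by blast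
  qed
  then have "order G = p ^ multiplicity p (order G)" using m(1) by simp
  then show ?thesis
    using fin is_group unfolding finite_p_group_def by blast
qed

text \<open>The class equation. Without a nontrivial central element, every conjugacy class except
  that of \<open>\<one>\<close> has size divisible by \<open>p\<close>, so \<open>p\<close> would
  divide 1.\<close>

lemma (in group) finite_p_group_center_nontrivial:
  assumes p: "Factorial_Ring.prime p" and G: "finite_p_group p G" and nt: "carrier G \<noteq> {\<one>}"
  shows "\<exists>x\<in>carrier G. x \<noteq> \<one> \<and> (\<forall>y\<in>carrier G. x \<otimes> y = y \<otimes> x)"
proof (rule ccontr)
  assume no: "\<not> ?thesis"
  define \<phi> where "\<phi> = (\<lambda>g. \<lambda>h \<in> carrier G. g \<otimes> h \<otimes> inv g)"
  interpret act: group_action G "carrier G" \<phi> unfolding \<phi>_def by (rule action_by_conjugation)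
  obtain k where k: "order G = p ^ k" and fin: "finite (carrier G)"
    using G by (auto simp: finite_p_group_def)
  have self: "x \<in> orbit G \<phi> x" if "x \<in> carrier G" for x
    using that by (rule act.orbit_refl)
  have orb: "p dvd card (orbit G \<phi> x)" if x: "x \<in> carrier G" "x \<noteq> \<one>" for x
  proof -
    have "card (orbit G \<phi> x) dvd p ^ k"
      using act.orbit_stabilizer_theorem[OF x(1)] unfolding k by (metis dvd_triv_left)
    then obtain j where j: "card (orbit G \<phi> x) = p ^ j"
      using divides_primepow_nat[OF p] by blast
    have "card (orbit G \<phi> x) \<noteq> 1"
    proof
      assume "card (orbit G \<phi> x) = 1"
      then have single: "orbit G \<phi> x = {x}"
        using self[OF x(1)] by (metis card_1_singletonE singletonD)
      have "x \<otimes> y = y \<otimes> x" if y: "y \<in> carrier G" for y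
      proof -
        have "y \<otimes> x \<otimes> inv y \<in> orbit G \<phi> x"
          using x(1) y by (auto simp: orbit_def \<phi>_def intro!: exI[of _ y])
        then have "y \<otimes> x \<otimes> inv y = x" using single by simp
        then show ?thesis using x(1) y inv_solve_right'[of x "y \<otimes> x" y] by simp
      qed
      then show False using no x by blast
    qed
    then show ?thesis using j by (cases j) auto
  qed
  have o1: "orbit G \<phi> \<one> = {\<one>}"
    using self[of \<one>] by (auto simp: orbit_def \<phi>_def)
  have fin_orbits: "finite (orbits G (carrier G) \<phi>)"
    using fin by (simp add: orbits_def Setcompr_eq_image)
  have "card (carrier G) = (\<Sum>orb\<in>orbits G (carrier G) \<phi>. card orb)"
    using act.disjoint_sum[OF fin, of "\<lambda>_. 1::nat"] by simp
  also have "\<dots> = 1 + (\<Sum>orb\<in>orbits G (carrier G) \<phi> - {{\<one>}}. card orb)"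
  proof -
    have "{\<one>} \<in> orbits G (carrier G) \<phi>"
      using o1 by (auto simp: orbits_def intro!: exI[of _ \<one>])
    then show ?thesis
      using sum.remove[OF fin_orbits, of "{\<one>}" card] by simp
  qed
  finally have eq: "p ^ k = 1 + (\<Sum>orb\<in>orbits G (carrier G) \<phi> - {{\<one>}}. card orb)"
    using k unfolding order_def by simp
  have "p dvd (\<Sum>orb\<in>orbits G (carrier G) \<phi> - {{\<one>}}. card orb)"
    using orb o1 by (intro dvd_sum) (auto simp: orbits_def)
  moreover have "k \<noteq> 0"
  proof
    assume "k = 0"
    then have "card (carrier G) = 1" using k by (simp add: order_def)
    then show False using nt by (metis card_1_singletonE one_closed singletonD)
  qed
  then have "p dvd p ^ k" by (simp add: dvd_power)
  ultimately have "p dvd 1"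
    unfolding eq using dvd_add_left_iff by blast
  then show False using p by simp
qed

lemma (in group) centralizer_mod_carrier_psubset:
  assumes p: "Factorial_Ring.prime p" and G: "finite_p_group p G"
    and U: "U \<lhd> G" "U \<noteq> carrier G"
  shows "U \<subset> centralizer_mod G (carrier G) U"
proof -
  interpret U: normal U G by fact
  interpret q: group_hom G "G Mod U" "(#>) U" by (rule U.group_hom_Mod)
  have carr: "carrier (G Mod U) = (#>) U ` carrier G"
    by (auto simp: FactGroup_def RCOSETS_def)
  obtain k where k: "order G = p ^ k" and fin: "finite (carrier G)"
    using G by (auto simp: finite_p_group_def)
  have "order (G Mod U) = card (rcosets U)" by (simp add: order_def FactGroup_def)
  then have "order (G Mod U) dvd p ^ k"
    using lagrange[OF normal_imp_subgroup[OF U(1)]] k by (metis dvd_triv_left)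
  then have "finite_p_group p (G Mod U)"
    unfolding finite_p_group_def
    using divides_primepow_nat[OF p] fin carr q.H.is_group by auto
  moreover have "carrier (G Mod U) \<noteq> {\<one>\<^bsub>G Mod U\<^esub>}"
  proof -
    obtain x where x: "x \<in> carrier G" "x \<notin> U" using U(2) U.subset by blast
    then have "U #> x \<noteq> \<one>\<^bsub>G Mod U\<^esub>" using U.coset_eq_one_iff[OF x(1)] by blast
    moreover have "U #> x \<in> carrier (G Mod U)" using x(1) by (rule q.hom_closed)
    ultimately show ?thesis by blast
  qed
  ultimately obtain c where c: "c \<in> carrier (G Mod U)" "c \<noteq> \<one>\<^bsub>G Mod U\<^esub>"
      "\<forall>y\<in>carrier (G Mod U). c \<otimes>\<^bsub>G Mod U\<^esub> y = y \<otimes>\<^bsub>G Mod U\<^esub> c"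
    using q.H.finite_p_group_center_nontrivial[OF p] by blast
  then obtain x where x: "x \<in> carrier G" "c = U #> x" unfolding carr by blast
  have "commutator G x y \<in> U" if y: "y \<in> carrier G" for y
    using c(3) q.hom_closed[OF y] U.commutator_mem_iff[OF x(1) y] unfolding x(2) by blast
  then have "x \<in> centralizer_mod G (carrier G) U" using x(1) by (simp add: centralizer_mod_def)
  moreover have "x \<notin> U" using c(2) U.coset_eq_one_iff[OF x(1)] unfolding x(2) by blast
  ultimately show ?thesis
    using subset_centralizer_mod[OF subset_refl U(1)] by blast
qed

lemma (in group) finite_p_group_nilpotent:
  assumes p: "Factorial_Ring.prime p" and G: "finite_p_group p G"
  obtains c where "(centralizer_mod G (carrier G) ^^ c) {\<one>} = carrier G"
proof -
  let ?Z = "\<lambda>n. (centralizer_mod G (carrier G) ^^ n) {\<one>}"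
  have Z: "?Z n \<lhd> G" for n by (rule centralizer_mod_funpow_normal[OF normal_self one_is_normal])
  have fin: "finite (carrier G)" using G by (simp add: finite_p_group_def)
  have finZ: "finite (?Z n)" for n using finite_subset[OF normal_subset[OF Z] fin] .
  have "\<exists>c. ?Z c = carrier G"
  proof (rule ccontr)
    assume "\<nexists>c. ?Z c = carrier G"
    then have lt: "?Z n \<subset> ?Z (Suc n)" for n
      using centralizer_mod_carrier_psubset[OF p G Z, of n] by simp
    have "n \<le> card (?Z n)" for n
    proof (induction n)
      case (Suc n)
      then show ?case using psubset_card_mono[OF finZ lt[of n]] by simp
    qed simp
    \<comment> \<open>A series that grows strictly forever has at least \<open>n\<close> elements in
      term \<open>n\<close>; the index exceeds the order of the group.\<close>
    from this[of "Suc (card (carrier G))"] show False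
      using card_mono[OF fin normal_subset[OF Z[of "Suc (card (carrier G))"]]] by simp
  qed
  then show ?thesis using that by blast
qed

text \<open>Cosets of \<open>{\<one>}\<close> are singletons, so the relative notion becomes the
  absolute one, and \<open>W \<subseteq> A\<close> gives \<open>[W, W] \<subseteq> [W, A]\<close>.
  What remains is the passage from \<open>G\<close> to \<open>W\<close> as a group.\<close>

lemma (in group) finite_powerful_p_groupI:
  assumes p: "Factorial_Ring.prime p" and W: "W \<lhd> G" "W \<subseteq> A" and pw: "powerful_mod G p W A {\<one>}"
  shows "finite_powerful_p_group p (G\<lparr>carrier := W\<rparr>)"
proof -
  note Wg = normal_imp_subgroup[OF W(1)] and Wc = normal_subset[OF W(1)]
  interpret GW: group "G\<lparr>carrier := W\<rparr>" by (rule subgroup_imp_group[OF Wg])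
  have "(\<lambda>x. {\<one>} #> x) ` W = (\<lambda>x. {x}) ` W"
    using Wc by (intro image_cong refl) (auto simp: r_coset_def)
  then have "finite W"
    using pw by (auto simp: powerful_mod_def finite_mod_def dest!: finite_imageD)
  moreover obtain e where "\<And>w. w \<in> W \<Longrightarrow> w [^] (p ^ e) = \<one>"
    using pw by (auto simp: powerful_mod_def)
  ultimately have "finite_p_group p (G\<lparr>carrier := W\<rparr>)"
    using GW.finite_p_group_of_exponent[OF p, of e] by (simp flip: nat_pow_consistent)
  moreover have "derived (G\<lparr>carrier := W\<rparr>) W \<subseteq> power_subgroup (G\<lparr>carrier := W\<rparr>) p"
  proof -
    have PW: "(\<lambda>x. x [^] p) ` W \<subseteq> W"
      using GW.nat_pow_closed by (auto simp flip: nat_pow_consistent)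
    have "derived (G\<lparr>carrier := W\<rparr>) W = commutator_subgroup G W W"
      using derived_consistent[OF subset_refl Wg] unfolding derived_eq_commutator_subgroup .
    also have "\<dots> \<subseteq> commutator_subgroup G W A"
      using W(2) by (intro commutator_subgroup_mono) auto
    also have "\<dots> \<subseteq> generate G ((\<lambda>x. x [^] p) ` W \<union> {\<one>})"
      using pw by (simp add: powerful_mod_def)
    also have "\<dots> \<subseteq> generate G ((\<lambda>x. x [^] p) ` W)"
      using PW Wc by (intro generate_subgroup_incl generate_is_subgroup) (auto intro: generate.incl generate.one)
    also have "\<dots> = power_subgroup (G\<lparr>carrier := W\<rparr>) p"
      unfolding power_subgroup_def using generate_consistent[OF PW Wg]
      by (simp flip: nat_pow_consistent)
    finally show ?thesis .
  qed
  ultimately show ?thesis by (simp add: finite_powerful_p_group_def)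
qed

section \<open>Lifting along the extension\<close>

text \<open>The start of both inductions. In the commutator condition, an element of the derived
  subgroup and a product of \<open>p\<close>-th powers (and inverses) with the same image differ by
  an element of the kernel.\<close>

lemma (in group_hom) powerful_mod_of_kernel:
  assumes surj: "h ` carrier G = carrier H" and H: "finite_powerful_p_group p H"
    and N: "kernel G H h \<subseteq> N" "N \<lhd> G"
  shows "powerful_mod G p (carrier G) (carrier G) N"
proof -
  obtain k where k: "order H = p ^ k" and fin: "finite (carrier H)"
    using H by (auto simp: finite_powerful_p_group_def finite_p_group_def)
  have ker: "x \<otimes> inv y \<in> N" if "x \<in> carrier G" "y \<in> carrier G" "h x = h y" for x y
    using that N(1) by (auto simp: kernel_def)
  have "finite_mod G (carrier G) N"
  proof (rule normal.finite_modI[OF N(2)])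
    show "finite (inv_into (carrier G) h ` carrier H)" using fin by simp
    show "inv_into (carrier G) h ` carrier H \<subseteq> carrier G"
      using inv_into_into[of _ h "carrier G"] surj by auto
    fix s assume s: "s \<in> carrier G"
    have "inv_into (carrier G) h (h s) \<in> carrier G" "h (inv_into (carrier G) h (h s)) = h s"
      using s inv_into_into[of "h s" h "carrier G"] f_inv_into_f[of "h s" h "carrier G"] by auto
    then have "s \<otimes> inv (inv_into (carrier G) h (h s)) \<in> N"
      using ker[OF s] by simp
    then show "\<exists>f\<in>inv_into (carrier G) h ` carrier H. s \<otimes> inv f \<in> N"
      by (rule bexI[OF _ imageI[OF hom_closed[OF s]]])
  qed simp
  moreover have "w [^] (p ^ k) \<in> N" if w: "w \<in> carrier G" for w
  proof -
    have "h (w [^] (p ^ k)) = \<one>\<^bsub>H\<^esub>"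
      unfolding hom_nat_pow[OF w] k[symmetric] using w by (intro H.pow_order_eq_1) simp
    then show ?thesis using w N(1) by (auto simp: kernel_def)
  qed
  moreover have "commutator_subgroup G (carrier G) (carrier G) \<subseteq>
      generate G ((\<lambda>x. x [^] p) ` carrier G \<union> N)" (is "_ \<subseteq> ?P")
  proof
    let ?pow = "(\<lambda>x. x [^] p) ` carrier G"
    have P: "?pow \<subseteq> carrier G" by auto
    have "?pow \<union> N \<subseteq> carrier G" using P G.normal_subset[OF N(2)] by auto
    then have Pg: "subgroup ?P G" by (rule G.generate_is_subgroup)
    have img: "h ` ?pow = (\<lambda>x. x [^]\<^bsub>H\<^esub> p) ` carrier H"
      unfolding surj[symmetric] image_image by (intro image_cong refl) (simp add: hom_nat_pow)
    fix x assume x: "x \<in> commutator_subgroup G (carrier G) (carrier G)"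
    then have xc: "x \<in> carrier G"
      using G.normal_subset[OF G.commutator_subgroup_normal[OF G.normal_self G.normal_self]] by blast
    have "h x \<in> h ` derived G (carrier G)"
      using x unfolding derived_eq_commutator_subgroup by blast
    then have "h x \<in> derived H (carrier H)"
      using derived_img[of "carrier G"] surj by simp
    then have "h x \<in> generate H ((\<lambda>x. x [^]\<^bsub>H\<^esub> p) ` carrier H)"
      using H unfolding finite_powerful_p_group_def power_subgroup_def by blast
    then have "h x \<in> h ` generate G ?pow"
      unfolding img[symmetric] generate_img[OF P] .
    then obtain y where y: "y \<in> generate G ?pow" "h x = h y" by blast
    have yc: "y \<in> carrier G" using G.generate_in_carrier[OF P y(1)] .
    have "x \<otimes> inv y \<in> ?P"
      using ker[OF xc yc y(2)] by (auto intro: generate.incl)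
    moreover have "y \<in> ?P"
      using y(1) G.mono_generate[of ?pow "?pow \<union> N"] by blast
    ultimately have "x \<otimes> inv y \<otimes> y \<in> ?P"
      using subgroup.m_closed[OF Pg] by blast
    then show "x \<in> ?P" using xc yc by (simp add: G.m_assoc)
  qed
  ultimately show ?thesis unfolding powerful_mod_def by blast
qed

lemma (in group_hom) preimage_centralizer_mod_funpow:
  assumes "kernel G H h \<subseteq> N" "x \<in> carrier G" "h x \<in> (centralizer_mod H (carrier H) ^^ k) {\<one>\<^bsub>H\<^esub>}"
  shows "x \<in> (centralizer_mod G (carrier G) ^^ k) N"
  using assms(2,3)
proof (induction k arbitrary: x)
  case 0
  then show ?case using assms(1) by (auto simp: kernel_def)
next
  case (Suc k)
  have "commutator G x a \<in> (centralizer_mod G (carrier G) ^^ k) N" if a: "a \<in> carrier G" for a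
  proof (rule Suc.IH)
    show "commutator G x a \<in> carrier G" using Suc.prems(1) a by simp
    show "h (commutator G x a) \<in> (centralizer_mod H (carrier H) ^^ k) {\<one>\<^bsub>H\<^esub>}"
    proof -
      have "h x \<in> centralizer_mod H (carrier H) ((centralizer_mod H (carrier H) ^^ k) {\<one>\<^bsub>H\<^esub>})"
        using Suc.prems(2) by simp
      then show ?thesis
        unfolding hom_commutator[OF Suc.prems(1) a] centralizer_mod_def[of H "carrier H" "(_ ^^ _) _"]
        using a by simp
    qed
  qed
  then show ?case
    using Suc.prems(1) centralizer_mod_def[of G "carrier G" "(centralizer_mod G (carrier G) ^^ k) N"] by simp
qed

theorem theoremB:
  fixes p :: nat
    and N :: "('a, 'm) monoid_scheme"
    and H :: "('b, 'n) monoid_scheme"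
    and G :: "('c, 'k) monoid_scheme"
    and f :: "'a \<Rightarrow> 'b" and g :: "'b \<Rightarrow> 'c"
  assumes "Factorial_Ring.prime p" and "odd p"
    and "group_extension N f H g G"
    and "finite_powerful_p_group p G"
  shows "(\<forall>n\<ge>1. f ` carrier N \<subseteq> upper_central H n \<longrightarrow>
             finite_powerful_p_group p (H\<lparr>carrier := lower_central H (n + 1)\<rparr>)) \<and>
         (\<forall>n\<ge>1. f ` carrier N \<subseteq> derived_center H n \<longrightarrow>
             finite_powerful_p_group p (H\<lparr>carrier := derived_series H (n + 1)\<rparr>))"
proof -
  have ext: "group H" "group G" "g \<in> hom H G" "g ` carrier H = carrier G"
    "f ` carrier N = kernel H G g"
    using assms(3) by (auto simp: group_extension_def epi_def)
  interpret g: group_hom H G g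
    using ext by (simp add: group_hom_def group_hom_axioms_def)
  \<comment> \<open>The length of a central series of \<open>G\<close>; its preimages show that the
    same \<open>c\<close> works in \<open>H\<close> above any normal subgroup that contains the
    kernel.\<close>
  obtain c where c: "(centralizer_mod G (carrier G) ^^ c) {\<one>\<^bsub>G\<^esub>} = carrier G"
    using g.H.finite_p_group_nilpotent[OF assms(1)] assms(4) unfolding finite_powerful_p_group_def by blast
  have nil: "(centralizer_mod H (carrier H) ^^ c) L = carrier H"
    if "kernel H G g \<subseteq> L" "L \<lhd> H" for L
  proof
    show "carrier H \<subseteq> (centralizer_mod H (carrier H) ^^ c) L"
      using g.preimage_centralizer_mod_funpow[OF that(1), of _ c] unfolding c by auto
  qed (rule g.G.normal_subset[OF g.G.centralizer_mod_funpow_normal[OF g.G.normal_self that(2)]])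
  note pw = g.powerful_mod_of_kernel[OF ext(4) assms(4)]
  have "finite_powerful_p_group p (H\<lparr>carrier := lower_central H (n + 1)\<rparr>)"
    if n: "f ` carrier N \<subseteq> upper_central H n" for n
  proof -
    have ker: "kernel H G g \<subseteq> upper_central H n" using n ext(5) by simp
    note Z = g.G.upper_central_normal[of n]
    \<comment> \<open>The last stage \<open>i = n\<close>, where the modulus is term 0 of the upper
      central series, that is \<open>{\<one>}\<close>.\<close>
    have "powerful_mod H p (lower_central H (Suc n)) (carrier H) (upper_central H (n - n))"
      by (rule g.G.powerful_mod_lower_central[OF pw[OF ker Z] assms(2) nil[OF ker Z] order_refl])
    then show ?thesis
      using g.G.finite_powerful_p_groupI[OF assms(1) g.G.lower_central_normal
          g.G.normal_subset[OF g.G.lower_central_normal]] by simp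
  qed
  moreover have "finite_powerful_p_group p (H\<lparr>carrier := derived_series H (n + 1)\<rparr>)"
    if n: "f ` carrier N \<subseteq> derived_center H n" for n
  proof -
    define L where "L = derived_centralizer H (carrier H) n"
    have L: "L \<lhd> H" unfolding L_def by (rule g.G.derived_centralizer_normal[OF g.G.normal_self])
    have ker: "kernel H G g \<subseteq> L"
      using n g.G.derived_center_subset ext(5) unfolding L_def by blast
    have D: "(derived H ^^ n) (carrier H) \<lhd> H"
      by (induction n) (auto intro: g.G.derived_is_normal g.G.normal_self)
    have "powerful_mod H p ((derived H ^^ n) (carrier H)) ((derived H ^^ n) (carrier H)) {\<one>\<^bsub>H\<^esub>}"
      by (rule g.G.powerful_mod_derived_series[OF g.G.normal_self L pw[OF ker L] assms(2) nil[OF ker L]])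
        (simp add: L_def)
    then show ?thesis
      using g.G.finite_powerful_p_groupI[OF assms(1) D subset_refl] by (simp add: derived_series_def)
  qed
  ultimately show ?thesis by blast
qed

end
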